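(* Let $n\ge 1$, let $(\alpha_{\mathbf a})_{\mathbf a\in\mathcal{T}_n}$ and $(\beta_{\mathbf a})_{\mathbf a\in\mathcal{T}_n}$ be families of complex numbers, and let $$H_S=\sum_{\mathbf a\in\mathcal{T}_n}\left(\alpha_{\mathbf a}C_{\mathbf a}+\overline{\alpha_{\mathbf a}}\,C_{\mathbf a}^\dagger\right),\qquad H_T=\sum_{\mathbf a\in\mathcal{T}_n}\left(\beta_{\mathbf a}C_{\mathbf a}+\overline{\beta_{\mathbf a}}\,C_{\mathbf a}^\dagger\right)$$ be the system and target Hamiltonians on the fermionic Fock space of $n$ modes. Let $r=|\mathrm{supp}(\boldsymbol\alpha)|$ and suppose $\mathrm{supp}(\boldsymbol\beta)\subseteq\mathrm{supp}(\boldsymbol\alpha)$. Then there exist $2r$ pulses $V_{\mathbf b_1},\dots,V_{\mathbf b_{2r}}$ with $\mathbf b_\mu\in\{-1,0,1\}^n$ and $2r$ nonnegative real numbers $\lambda_{\mathbf b_1},\dots,\lambda_{\mathbf b_{2r}}$ such that $$U_{\mathrm{eng}}(t)=\prod_{\mu=1}^{2r}V_{\mathbf b_\mu}^\dagger\,e^{-itH_S\lambda_{\mathbf b_\mu}}\,V_{\mathbf b_\mu}\approx e^{-iH_Tt},$$ with the approximation error bounded by the standard Trotter scaling, in the following sense. Put $H_{\mathbf b_\mu}=\lambda_{\mathbf b_\mu}V_{\mathbf b_\mu}^\dagger H_SV_{\mathbf b_\mu}$ and $\|H_T\|_1:=\sum_{\mu=1}^{2r}\|H_{\mathbf b_\mu}\|$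 (operator norm). For each integer $p\ge1$ there is a constant $K_p$ depending only on $p$ such that, when the product is replaced by the $2p$-th order product formula $S_{2p}$ for the terms $H_{\mathbf b_1},\dots,H_{\mathbf b_{2r}}$ with $n_T\ge 1$ Trotter cycles, for all $t\ge0$ $$\left\|S_{2p}(t/n_T)^{n_T}-e^{-iH_Tt}\right\|\le K_p\,\frac{\|H_T\|_1^{2p+1}\,t^{2p+1}}{n_T^{2p}}.$$
   Context: The Fock space of $n$ fermionic modes is $\mathcal{F}=\bigoplus_{j=0}^n\bigwedge^j\mathbb{C}^n$. On it act the annihilation and creation operators $c_j,c_j^\dagger$, which satisfy $\{c_j,c_k^\dagger\}=\delta_{jk}$ and $\{c_j,c_k\}=\{c_j^\dagger,c_k^\dagger\}=0$. The number operators are $n_j=c_j^\dagger c_j$. Let $\mathbb{T}=\{-1,0,1\}$. For $a\in\mathbb{T}$ set $C^{(j)}_0=\mathbb{1}$, $C^{(j)}_{1}=c_j^\dagger$, $C^{(j)}_{-1}=c_j$. For $\mathbf a\in\mathbb{T}^n$ set $C_{\mathbf a}=C^{(1)}_{a_1}C^{(2)}_{a_2}\cdots C^{(n)}_{a_n}$. $\mathcal{T}_n\subset\mathbb{T}^n\setminus\{\mathbf 0\}$ is the set of strings whose first nonzero entry is $1$, so that $\mathbb{T}^n\setminus\{\mathbf 0\}=\mathcal{T}_n\sqcup(-\mathcal{T}_n)$. The support of a family $\boldsymbol v=(v_{\mathbf a})_{\mathbf a\in\mathcal{T}_n}$ is $\mathrm{supp}(\boldsymbol v)=\{\mathbf a\in\mathcal{T}_n: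 v_{\mathbf a}\ne0\}$. Pulses: $V_j=\exp(-\tfrac{2\pi i}{3}n_j)$ and $V_{\mathbf b}=\prod_{j=1}^nV_j^{b_j}$ for $\mathbf b\in\mathbb{T}^n$. Product formulas (Suzuki–Trotter) for terms $H_1,\dots,H_L$: $$S_2(s)=\left(e^{-iH_1s/2}\cdots e^{-iH_Ls/2}\right)\left(e^{-iH_Ls/2}\cdots e^{-iH_1s/2}\right),$$ and recursively for $p\ge2$, $$S_{2p}(s)=S_{2p-2}(u_ps)^2\,S_{2p-2}((1-4u_p)s)\,S_{2p-2}(u_ps)^2,\qquad u_p=\frac{1}{4-4^{1/(2p-1)}}.$$ Each factor satisfies $e^{-isH_{\mathbf b_\mu}}=V_{\mathbf b_\mu}^\dagger e^{-is\lambda_{\mathbf b_\mu}H_S}V_{\mathbf b_\mu}$. *)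

theory Defs
  imports
    "Jordan_Normal_Form.Schur_Decomposition"
    "HOL-Analysis.L2_Norm"
    "HOL-Library.FuncSet"
    "HOL-Library.Nat_Bijection"
begin

text \<open>
  The Fock space of the modes \<open>1, \<dots>, n\<close> is represented in the orthonormal basis
  \<open>e\<^sub>S = e\<^bsub>j\<^sub>1\<^esub> \<and> \<dots> \<and> e\<^bsub>j\<^sub>m\<^esub>\<close>, where \<open>S = {j\<^sub>1 < \<dots> < j\<^sub>m} \<subseteq> {1..n}\<close>, so that operators are
  complex matrices of dimension \<open>2 ^ n\<close>.  The basis vector with index \<open>x < 2 ^ n\<close> is \<open>e\<^sub>S\<close> for
  \<open>S = occ x\<close>; mode \<open>j\<close> corresponds to the binary digit of weight \<open>2 ^ (j - 1)\<close>.
\<close>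

abbreviation fock_dim :: "nat \<Rightarrow> nat"
  where "fock_dim n \<equiv> 2 ^ n"

definition occ :: "nat \<Rightarrow> nat set"
  where "occ x = Suc ` set_decode x"

text \<open>
  The creation operator is \<open>e\<^sub>S \<mapsto> e\<^sub>j \<and> e\<^sub>S\<close>; the sign comes from moving \<open>e\<^sub>j\<close> to its place
  in the ordered wedge product.
\<close>

definition creation :: "nat \<Rightarrow> nat \<Rightarrow> complex mat"
  where "creation n j = mat (fock_dim n) (fock_dim n)
    (\<lambda>(x, y). if j \<notin> occ y \<and> occ x = insert j (occ y)
              then (- 1) ^ card {l \<in> occ y. l < j} else 0)"

definition annihilation :: "nat \<Rightarrow> nat \<Rightarrow> complex mat"
  where "annihilation n j = mat_adjoint (creation n j)"

definition number_op :: "nat \<Rightarrow> nat \<Rightarrow> complex mat"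
  where "number_op n j = creation n j * annihilation n j"

abbreviation op_ring :: "nat \<Rightarrow> complex mat ring"
  where "op_ring n \<equiv> ring_mat TYPE(complex) (fock_dim n) ()"

definition op_prod :: "nat \<Rightarrow> complex mat list \<Rightarrow> complex mat"
  where "op_prod n As = foldr (*) As (1\<^sub>m (fock_dim n))"

definition mat_exp :: "complex mat \<Rightarrow> complex mat"
  where "mat_exp A = mat (dim_row A) (dim_col A) (\<lambda>(x, y). \<Sum>k. (A ^\<^sub>m k) $$ (x, y) / fact k)"

definition evolution :: "complex mat \<Rightarrow> real \<Rightarrow> complex mat"
  where "evolution H s = mat_exp ((- (\<i> * complex_of_real s)) \<cdot>\<^sub>m H)"

definition vec_norm2 :: "complex vec \<Rightarrow> real"
  where "vec_norm2 v = L2_set (\<lambda>x. cmod (v $ x)) {..<dim_vec v}"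

definition op_norm :: "complex mat \<Rightarrow> real"
  where "op_norm A = Sup {vec_norm2 (A *\<^sub>v v) |v. v \<in> carrier_vec (dim_col A) \<and> vec_norm2 v = 1}"

text \<open>Strings in \<open>{-1, 0, 1}\<^sup>n\<close>, with entries numbered from \<open>1\<close> to \<open>n\<close>.\<close>

definition strings :: "nat \<Rightarrow> (nat \<Rightarrow> int) set"
  where "strings n = {1..n} \<rightarrow>\<^sub>E {- 1, 0, 1}"

definition pos_strings :: "nat \<Rightarrow> (nat \<Rightarrow> int) set"
  where "pos_strings n = {a \<in> strings n. \<exists>j\<in>{1..n}. a j = 1 \<and> (\<forall>i\<in>{1..<j}. a i = 0)}"

definition supp :: "nat \<Rightarrow> ((nat \<Rightarrow> int) \<Rightarrow> complex) \<Rightarrow> (nat \<Rightarrow> int) set"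
  where "supp n v = {a \<in> pos_strings n. v a \<noteq> 0}"

definition C_mode :: "nat \<Rightarrow> nat \<Rightarrow> int \<Rightarrow> complex mat"
  where "C_mode n j z = (if z = 1 then creation n j
                         else if z = - 1 then annihilation n j
                         else 1\<^sub>m (fock_dim n))"

definition C_string :: "nat \<Rightarrow> (nat \<Rightarrow> int) \<Rightarrow> complex mat"
  where "C_string n a = op_prod n (map (\<lambda>j. C_mode n j (a j)) [1..<n + 1])"

definition hamiltonian :: "nat \<Rightarrow> ((nat \<Rightarrow> int) \<Rightarrow> complex) \<Rightarrow> complex mat"
  where "hamiltonian n v = (\<Oplus>\<^bsub>op_ring n\<^esub>a\<in>pos_strings n.
           v a \<cdot>\<^sub>m C_string n a + cnj (v a) \<cdot>\<^sub>m mat_adjoint (C_string n a))"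

definition pulse_mode :: "nat \<Rightarrow> nat \<Rightarrow> complex mat"
  where "pulse_mode n j = mat_exp ((- (2 * complex_of_real pi * \<i> / 3)) \<cdot>\<^sub>m number_op n j)"

text \<open>Since \<open>b j\<close> is an integer, the power below may be an inverse in the ring of operators.\<close>

definition pulse :: "nat \<Rightarrow> (nat \<Rightarrow> int) \<Rightarrow> complex mat"
  where "pulse n b = op_prod n (map (\<lambda>j. pulse_mode n j [^]\<^bsub>op_ring n\<^esub> b j) [1..<n + 1])"

text \<open>
  \<open>suzuki n Hs p\<close> is the product formula of order \<open>2p\<close> for the list of terms \<open>Hs\<close>; the
  formula is meaningful for \<open>p \<ge> 1\<close>, and its value at \<open>p = 0\<close> is arbitrary.
\<close>

definition suzuki_u :: "nat \<Rightarrow> real"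
  where "suzuki_u p = 1 / (4 - 4 powr (1 / (2 * real p - 1)))"

definition strang :: "nat \<Rightarrow> complex mat list \<Rightarrow> real \<Rightarrow> complex mat"
  where "strang n Hs s = op_prod n (map (\<lambda>H. evolution H (s / 2)) Hs)
                       * op_prod n (map (\<lambda>H. evolution H (s / 2)) (rev Hs))"

fun suzuki :: "nat \<Rightarrow> complex mat list \<Rightarrow> nat \<Rightarrow> real \<Rightarrow> complex mat"
  where
    "suzuki n Hs 0 s = 1\<^sub>m (fock_dim n)"
  | "suzuki n Hs (Suc 0) s = strang n Hs s"
  | "suzuki n Hs (Suc (Suc q)) s =
       (let u = suzuki_u (Suc (Suc q)) in
          suzuki n Hs (Suc q) (u * s) ^\<^sub>m 2
          * suzuki n Hs (Suc q) ((1 - 4 * u) * s)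
          * suzuki n Hs (Suc q) (u * s) ^\<^sub>m 2)"

text \<open>
  The toggled term \<open>\<lambda>\<^sub>b V\<^sub>b\<^sup>\<dagger> H V\<^sub>b\<close>, and the pulsed evolution
  \<open>V\<^sub>b\<^sup>\<dagger> exp (- i s \<lambda>\<^sub>b H) V\<^sub>b\<close> by which it is implemented.
\<close>

definition toggled_term ::
    "nat \<Rightarrow> complex mat \<Rightarrow> ((nat \<Rightarrow> int) \<Rightarrow> real) \<Rightarrow> (nat \<Rightarrow> int) \<Rightarrow> complex mat"
  where "toggled_term n H lam b =
    complex_of_real (lam b) \<cdot>\<^sub>m (mat_adjoint (pulse n b) * H * pulse n b)"

definition pulsed_evolution ::
    "nat \<Rightarrow> complex mat \<Rightarrow> ((nat \<Rightarrow> int) \<Rightarrow> real) \<Rightarrow> (nat \<Rightarrow> int) \<Rightarrow> real \<Rightarrow> complex mat"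
  where "pulsed_evolution n H lam b s =
    mat_adjoint (pulse n b) * evolution H (s * lam b) * pulse n b"

definition U_eng ::
    "nat \<Rightarrow> complex mat \<Rightarrow> ((nat \<Rightarrow> int) \<Rightarrow> real) \<Rightarrow> (nat \<Rightarrow> int) list \<Rightarrow> real \<Rightarrow> complex mat"
  where "U_eng n H lam bs t = op_prod n (map (\<lambda>b. pulsed_evolution n H lam b t) bs)"

end

theory Submission
  imports
    Defs
    "HOL-Analysis.Analysis"
    "HOL-Computational_Algebra.Formal_Power_Series"
begin

text \<open>
  Conjugation by the pulse \<open>V\<^sub>b\<close> multiplies \<open>C\<^sub>a\<close> by \<open>\<omega>\<^bsup>a \<cdot> b\<^esup>\<close>, where \<open>\<omega> = exp (2 \<pi> \<i> / 3)\<close>, because \<open>C\<^sub>a\<close>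
  changes the occupation numbers by \<open>a\<close>.  So the toggled terms sum to the target as soon as
  \<open>\<Sum>\<^sub>b \<lambda>\<^sub>b \<omega>\<^bsup>a \<cdot> b\<^esup> = \<beta>\<^sub>a / \<alpha>\<^sub>a\<close> on the support of \<open>\<alpha>\<close>.  Orthogonality of the characters of
  \<open>{-1, 0, 1}\<^sup>n\<close> (addition modulo 3) solves this with real weights; adding a constant makes them
  nonnegative and preserves the equations, since none of them involves the trivial character.
  These are \<open>2r\<close> real equations, so by Caratheodory's argument \<open>2r\<close> of the weights suffice.

  For the error, the Taylor coefficients of the product formula agree with those of the exact
  evolution up to order \<open>2p\<close>: the recursion cancels the odd order, and time reversal symmetry the
  even one.  The higher coefficients are dominated by those of \<open>exp (c\<^sub>p \<Lambda> s)\<close>, where \<open>\<Lambda>\<close> is the sum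
  of the norms of the terms and \<open>c\<^sub>p\<close> depends on \<open>p\<close> only; this settles \<open>\<Lambda> s \<le> 1\<close>.  Unitarity handles
  \<open>\<Lambda> s > 1\<close> and the passage from one Trotter cycle to many.
\<close>

hide_const (open) Finite_Cartesian_Product.vec Finite_Cartesian_Product.mat

section \<open>Order conditions for Suzuki formulas as formal power series\<close>

text \<open>If \<open>f\<close> is the series of \<open>F\<close> in the time \<open>s\<close>, this
  is the series of \<open>F (u * s)\<close>. The rescaled steps of the recursion and, for
  \<open>u = - 1\<close>, time reversal both act in this way.\<close>

definition fps_dilate :: "real \<Rightarrow> 'a::real_algebra_1 fps \<Rightarrow> 'a fps"
  where "fps_dilate u f = Abs_fps (\<lambda>k. u ^ k *\<^sub>R fps_nth f k)"

lemma fps_dilate_nth [simp]: "fps_nth (fps_dilate u f) k = u ^ k *\<^sub>R fps_nth f k"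
  by (simp add: fps_dilate_def)

lemma fps_dilate_one [simp]: "fps_dilate u 1 = 1"
  by (rule fps_ext) simp

lemma fps_dilate_mult: "fps_dilate u (f * g) = fps_dilate u f * fps_dilate u g"
proof (rule fps_ext)
  fix k
  have "u ^ (k - i) * u ^ i = u ^ k" if "i \<le> k" for i
    using that by (simp add: power_add [symmetric])
  then show "fps_nth (fps_dilate u (f * g)) k = fps_nth (fps_dilate u f * fps_dilate u g) k"
    by (simp add: fps_mult_nth scaleR_sum_right cong: sum.cong_simp)
qed

lemma fps_dilate_dilate: "fps_dilate u (fps_dilate v f) = fps_dilate (u * v) f"
  by (rule fps_ext) (simp add: power_mult_distrib)

definition fps_expo :: "'a::real_algebra_1 \<Rightarrow> 'a fps"
  where "fps_expo A = Abs_fps (\<lambda>k. A ^ k /\<^sub>R fact k)"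

lemma fps_expo_nth [simp]: "fps_nth (fps_expo A) k = A ^ k /\<^sub>R fact k"
  by (simp add: fps_expo_def)

lemma fps_dilate_expo:
  fixes A :: "'a::real_normed_algebra_1"
  shows "fps_dilate u (fps_expo A) = fps_expo (u *\<^sub>R A)"
  by (rule fps_ext) (simp add: mult.commute)

lemma fps_expo_zero [simp]: "fps_expo 0 = 1"
  by (rule fps_ext) (simp add: power_0_left)

lemma fps_expo_mult_scaleR:
  fixes A :: "'a::{real_normed_algebra_1,banach}"
  shows "fps_expo (u *\<^sub>R A) * fps_expo (v *\<^sub>R A) = fps_expo ((u + v) *\<^sub>R A)"
proof (rule fps_ext)
  fix k
  have "(u *\<^sub>R A) * (v *\<^sub>R A) = (v *\<^sub>R A) * (u *\<^sub>R A)"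
    by simp
  from exp_series_add_commuting [OF this, of k]
  show "fps_nth (fps_expo (u *\<^sub>R A) * fps_expo (v *\<^sub>R A)) k = fps_nth (fps_expo ((u + v) *\<^sub>R A)) k"
    by (simp add: fps_mult_nth scaleR_add_left atLeast0AtMost)
qed

lemma fps_expo_minus_mult:
  fixes A :: "'a::{real_normed_algebra_1,banach}"
  shows "fps_expo A * fps_expo (- A) = 1"
  using fps_expo_mult_scaleR [of 1 A "- 1"] by simp

definition agree_below :: "nat \<Rightarrow> 'a::ring_1 fps \<Rightarrow> 'a fps \<Rightarrow> bool"
  where "agree_below m f g \<longleftrightarrow> (\<forall>k<m. fps_nth f k = fps_nth g k)"

lemma agree_below_mult:
  assumes "agree_below m f f'" "agree_below m g g'"
  shows "agree_below m (f * g) (f' * g')"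
  using assms unfolding agree_below_def by (auto simp: fps_mult_nth intro!: sum.cong)

text \<open>In the coefficient of order \<open>m\<close> the mixed terms involve only orders
  strictly between \<open>0\<close> and \<open>m\<close>, where the factors agree, and in the two
  outer terms one factor is the constant coefficient \<open>1\<close>. So the first deviations of
  the factors add up.\<close>

lemma nth_mult_diff:
  fixes f g :: "'a::ring_1 fps"
  assumes "agree_below m f f'" "agree_below m g g'" "0 < m"
    and "fps_nth f' 0 = 1" "fps_nth g' 0 = 1"
  shows "fps_nth (f * g) m - fps_nth (f' * g') m
    = (fps_nth f m - fps_nth f' m) + (fps_nth g m - fps_nth g' m)"
proof -
  have split: "fps_nth (p * q) m
      = fps_nth p 0 * fps_nth q m + (\<Sum>i\<in>{0<..<m}. fps_nth p i * fps_nth q (m - i))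
        + fps_nth p m * fps_nth q 0" for p q :: "'a fps"
  proof -
    have "{0..m} = insert 0 (insert m {0<..<m})" using assms by auto
    then show ?thesis using assms by (simp add: fps_mult_nth add_ac)
  qed
  have "(\<Sum>i\<in>{0<..<m}. fps_nth f i * fps_nth g (m - i))
      = (\<Sum>i\<in>{0<..<m}. fps_nth f' i * fps_nth g' (m - i))"
    using assms by (intro sum.cong) (auto simp: agree_below_def)
  moreover have "fps_nth f 0 = 1" "fps_nth g 0 = 1"
    using assms by (auto simp: agree_below_def)
  ultimately show ?thesis using assms(4,5) by (simp add: split)
qed

text \<open>At an even order the first deviation enters \<open>f(s) f(-s) = 1\<close> twice with the same sign.\<close>

lemma agree_below_Suc_even:
  fixes f g :: "'a::real_algebra_1 fps"
  assumes agree: "agree_below m f g" and "even m" "0 < m"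
    and "f * fps_dilate (- 1) f = 1" "g * fps_dilate (- 1) g = 1" "fps_nth g 0 = 1"
  shows "agree_below (Suc m) f g"
proof -
  have "agree_below m (fps_dilate (- 1) f) (fps_dilate (- 1) g)"
    using agree by (simp add: agree_below_def)
  from nth_mult_diff [OF agree this] assms
  have "0 = (fps_nth f m - fps_nth g m) + (fps_nth f m - fps_nth g m)"
    by simp
  then have "2 *\<^sub>R (fps_nth f m - fps_nth g m) = 0"
    by (simp add: scaleR_2)
  then have "fps_nth f m = fps_nth g m" by simp
  with agree show ?thesis by (auto simp: agree_below_def less_Suc_eq)
qed

text \<open>With \<open>z\<close> as in the proof, the middle step is
  \<open>1 - 4 * u = - z * u\<close>, and \<open>z ^ (2 * q + 3) = 4\<close> with an odd exponent.
  The equation says that the errors of order \<open>2 * q + 3\<close> of the four outer steps and of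
  the middle one cancel.\<close>

lemma suzuki_u_root:
  "4 * suzuki_u (Suc (Suc q)) ^ (2 * q + 3) + (1 - 4 * suzuki_u (Suc (Suc q))) ^ (2 * q + 3) = 0"
proof -
  define z :: real where "z = 4 powr (1 / (2 * real (Suc (Suc q)) - 1))"
  have e: "2 * real (Suc (Suc q)) - 1 = real (2 * q + 3)" by simp
  have "z ^ (2 * q + 3) = 4"
    unfolding z_def e by (subst powr_realpow [symmetric]) (simp_all add: powr_powr)
  \<comment> \<open>Keeps the denominator \<open>4 - z\<close> away from 0.\<close>
  have "z < 4 powr 1"
    unfolding z_def e by (intro powr_less_mono) auto
  then have "1 - 4 * (1 / (4 - z)) = - z * (1 / (4 - z))"
    by (simp add: field_simps)
  then show ?thesis
    using \<open>z ^ (2 * q + 3) = 4\<close>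
    by (simp only: suzuki_u_def z_def [symmetric] power_mult_distrib) (simp add: power_minus_odd)
qed

definition strang_fps :: "'a::{real_normed_algebra_1,banach} list \<Rightarrow> 'a fps"
  where "strang_fps As = prod_list (map (\<lambda>A. fps_expo ((1/2) *\<^sub>R A)) As)
    * prod_list (map (\<lambda>A. fps_expo ((1/2) *\<^sub>R A)) (rev As))"

text \<open>The recursion of \<open>suzuki\<close> on the level of Taylor series in the time: a step
  of relative length \<open>u\<close> becomes a dilation by \<open>u\<close>.\<close>

fun suzuki_fps :: "'a::{real_normed_algebra_1,banach} list \<Rightarrow> nat \<Rightarrow> 'a fps"
  where
    "suzuki_fps As 0 = 1"
  | "suzuki_fps As (Suc 0) = strang_fps As"
  | "suzuki_fps As (Suc (Suc q)) =
      (let u = suzuki_u (Suc (Suc q)); a = fps_dilate u (suzuki_fps As (Suc q)) in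
        a ^ 2 * fps_dilate (1 - 4 * u) (suzuki_fps As (Suc q)) * a ^ 2)"

lemma fps_dilate_prod_list:
  "fps_dilate u (prod_list fs) = prod_list (map (fps_dilate u) fs)"
  by (induction fs) (simp_all add: fps_dilate_mult)

lemma prod_list_rev_inverse:
  fixes f g :: "'b \<Rightarrow> 'a::monoid_mult"
  assumes "\<And>x. f x * g x = 1"
  shows "prod_list (map f xs) * prod_list (map g (rev xs)) = 1"
proof (induction xs)
  case (Cons x xs)
  have "prod_list (map f (x # xs)) * prod_list (map g (rev (x # xs)))
      = f x * (prod_list (map f xs) * prod_list (map g (rev xs))) * g x"
    by (simp add: mult.assoc)
  with Cons assms show ?case by simp
qed simp

text \<open>The Strang product is a palindrome. Time reversal inverts each factor and keeps their
  order, so the two copies cancel from the middle outwards.\<close>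

lemma strang_fps_reverse: "strang_fps As * fps_dilate (- 1) (strang_fps As) = 1"
proof -
  let ?e = "\<lambda>A. fps_expo ((1/2) *\<^sub>R A)" and ?e' = "\<lambda>A. fps_expo (- ((1/2) *\<^sub>R A))"
  have d: "fps_dilate (- 1) (strang_fps As)
      = prod_list (map ?e' As) * prod_list (map ?e' (rev As))"
    by (simp add: strang_fps_def fps_dilate_mult fps_dilate_prod_list fps_dilate_expo o_def)
  have r: "prod_list (map ?e xs) * prod_list (map ?e' (rev xs)) = 1" for xs :: "'a list"
    by (rule prod_list_rev_inverse) (rule fps_expo_minus_mult)
  have "strang_fps As * fps_dilate (- 1) (strang_fps As)
     = prod_list (map ?e As) * (prod_list (map ?e (rev As)) * prod_list (map ?e' As))
       * prod_list (map ?e' (rev As))"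
    unfolding d by (simp only: strang_fps_def mult.assoc)
  also have "\<dots> = 1" using r [of As] r [of "rev As"] by simp
  finally show ?thesis .
qed

text \<open>\<open>a ^ 2 * b * a ^ 2\<close> is again a palindrome, so reversibility passes from the
  factors to the product.\<close>

lemma suzuki_fps_reverse: "suzuki_fps As p * fps_dilate (- 1) (suzuki_fps As p) = 1"
proof (induction As p rule: suzuki_fps.induct)
  case (3 As q)
  define u where "u = suzuki_u (Suc (Suc q))"
  define a b where "a = fps_dilate u (suzuki_fps As (Suc q))"
    and "b = fps_dilate (1 - 4 * u) (suzuki_fps As (Suc q))"
  define a' b' where "a' = fps_dilate (- 1) a" and "b' = fps_dilate (- 1) b"
  have IH: "suzuki_fps As (Suc q) * fps_dilate (- 1) (suzuki_fps As (Suc q)) = 1"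
    by (rule 3) (auto simp: u_def)
  have dil: "fps_dilate v (suzuki_fps As (Suc q)) * fps_dilate (- 1) (fps_dilate v (suzuki_fps As (Suc q))) = 1" for v
    using arg_cong [OF IH, of "fps_dilate v"]
    by (simp add: fps_dilate_mult fps_dilate_dilate)
  have aa: "a * a' = 1" "b * b' = 1"
    using dil by (simp_all add: a_def a'_def b_def b'_def)
  have aa2: "a * (a' * x) = x" "b * (b' * x) = x" for x
    by (simp_all add: aa mult.assoc [symmetric])
  have "suzuki_fps As (Suc (Suc q)) = a ^ 2 * b * a ^ 2"
    by (simp add: Let_def a_def b_def u_def)
  then have "suzuki_fps As (Suc (Suc q)) * fps_dilate (- 1) (suzuki_fps As (Suc (Suc q)))
      = (a ^ 2 * b * a ^ 2) * (a' ^ 2 * b' * a' ^ 2)"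
    by (simp add: fps_dilate_mult a'_def b'_def power2_eq_square)
  also have "\<dots> = 1"
    by (simp add: power2_eq_square mult.assoc aa aa2)
  finally show ?case .
qed (simp_all add: strang_fps_reverse)

text \<open>To first order the sequence of the factors does not matter. No higher order is computed
  by hand: the second order of the Strang product comes from its symmetry.\<close>

lemma prod_list_fps_expo_nth:
  "fps_nth (prod_list (map (\<lambda>A. fps_expo (c *\<^sub>R A)) As)) 0 = 1 \<and>
   fps_nth (prod_list (map (\<lambda>A. fps_expo (c *\<^sub>R A)) As)) (Suc 0) = c *\<^sub>R sum_list As"
proof (induction As)
  case (Cons A As)
  then show ?case
    by (simp add: fps_mult_nth scaleR_add_right add.commute)
qed simp

lemma suzuki_fps_order:
  "0 < p \<Longrightarrow> agree_below (2 * p + 1) (suzuki_fps As p) (fps_expo (sum_list As))"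
proof (induction As p rule: suzuki_fps.induct)
  case (2 As)
  have "sum_list (rev As) = sum_list As"
    by (metis sum_mset_sum_list mset_rev)
  moreover have "(1/2) *\<^sub>R x + (1/2) *\<^sub>R x = x" for x :: 'a
    by (simp flip: scaleR_add_left)
  ultimately have "agree_below 2 (suzuki_fps As (Suc 0)) (fps_expo (sum_list As))"
    using prod_list_fps_expo_nth [of "1/2" As] prod_list_fps_expo_nth [of "1/2" "rev As"]
    by (auto simp: agree_below_def strang_fps_def less_2_cases_iff fps_mult_nth)
  \<comment> \<open>The order 2 is even, so time reversal supplies it.\<close>
  from agree_below_Suc_even [OF this]
  have "agree_below (Suc 2) (suzuki_fps As (Suc 0)) (fps_expo (sum_list As))"
    using suzuki_fps_reverse [of As "Suc 0"] fps_expo_minus_mult [of "sum_list As"]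
    by (simp add: fps_dilate_expo)
  then show ?case by (simp add: numeral_3_eq_3 numeral_2_eq_2)
next
  case (3 As q)
  define m where "m = 2 * q + 3"
  define u where "u = suzuki_u (Suc (Suc q))"
  define S E where "S = suzuki_fps As (Suc q)" and "E = (\<lambda>v. fps_expo (v *\<^sub>R sum_list As))"
  have IH: "agree_below m S (fps_expo (sum_list As))"
    using "3.IH" [OF u_def] by (simp add: m_def S_def numeral_3_eq_3)
  \<comment> \<open>\<open>dev c f v\<close>: below order \<open>m\<close>, \<open>f\<close> follows
    the evolution over the time \<open>v\<close>, and at order \<open>m\<close> it misses it by
    \<open>c\<close> times the error of the unit step \<open>S\<close>. Products add both
    \<open>c\<close> and \<open>v\<close>; the dilation of \<open>S\<close> by \<open>v\<close> has
    \<open>c = v ^ m\<close>.\<close>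
  define dev where "dev c f v \<longleftrightarrow> agree_below m f (E v)
    \<and> fps_nth f m - fps_nth (E v) m = c *\<^sub>R (fps_nth S m - fps_nth (E 1) m)" for c f v
  have "m > 0" by (simp add: m_def)
  have E0: "fps_nth (E v) 0 = 1" for v by (simp add: E_def)
  have EE: "E v * E w = E (v + w)" for v w
    by (simp add: E_def fps_expo_mult_scaleR)
  have dil: "dev (v ^ m) (fps_dilate v S) v" for v
    using IH by (simp add: dev_def agree_below_def E_def scaleR_diff_right mult.commute)
  have mult: "dev (c + c') (f * f') (v + v')" if "dev c f v" "dev c' f' v'" for c c' f f' v v'
    using that agree_below_mult [of m f "E v" f' "E v'"]
      nth_mult_diff [of m f "E v" f' "E v'", OF _ _ \<open>m > 0\<close> E0 E0]
    by (simp only: dev_def EE scaleR_add_left)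
  let ?a = "fps_dilate u S" and ?b = "fps_dilate (1 - 4 * u) S"
  have "dev (u ^ m + u ^ m + (1 - 4 * u) ^ m + (u ^ m + u ^ m)) (?a * ?a * ?b * (?a * ?a))
      (u + u + (1 - 4 * u) + (u + u))"
    by (intro mult dil)
  then have a2ba2: "agree_below m (?a * ?a * ?b * (?a * ?a)) (E 1)"
    "fps_nth (?a * ?a * ?b * (?a * ?a)) m - fps_nth (E 1) m
      = (4 * u ^ m + (1 - 4 * u) ^ m) *\<^sub>R (fps_nth S m - fps_nth (E 1) m)"
    by (simp_all add: dev_def algebra_simps)
  have S: "suzuki_fps As (Suc (Suc q)) = ?a * ?a * ?b * (?a * ?a)"
    by (simp add: Let_def u_def S_def power2_eq_square)
  \<comment> \<open>The step length is chosen to satisfy exactly this equation.\<close>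
  have "4 * u ^ m + (1 - 4 * u) ^ m = 0"
    unfolding u_def m_def by (rule suzuki_u_root)
  then have "fps_nth (suzuki_fps As (Suc (Suc q))) m = fps_nth (E 1) m"
    using a2ba2(2) unfolding S by simp
  then have "agree_below (Suc m) (suzuki_fps As (Suc (Suc q))) (E 1)"
    using a2ba2(1) unfolding S agree_below_def by (auto simp: less_Suc_eq)
  \<comment> \<open>\<open>Suc m = 2 * q + 4\<close> is even, so symmetry gains one more
    order.\<close>
  from agree_below_Suc_even [OF this]
  have "agree_below (Suc (Suc m)) (suzuki_fps As (Suc (Suc q))) (E 1)"
    using suzuki_fps_reverse [of As "Suc (Suc q)"] fps_expo_minus_mult [of "sum_list As"] E0
    by (simp add: fps_dilate_expo E_def m_def del: suzuki_fps.simps)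
  then show ?case by (simp add: m_def E_def numeral_3_eq_3 del: suzuki_fps.simps)
qed simp

section \<open>Functions with Taylor coefficients dominated by a scalar exponential\<close>

definition has_expansion :: "(real \<Rightarrow> 'a::{real_normed_algebra_1,banach}) \<Rightarrow> 'a fps \<Rightarrow> real \<Rightarrow> bool"
  where "has_expansion F f M \<longleftrightarrow> 0 \<le> M \<and> (\<forall>k. norm (fps_nth f k) \<le> M ^ k / fact k)
    \<and> (\<forall>s. (\<lambda>k. s ^ k *\<^sub>R fps_nth f k) sums F s)"

lemma has_expansion_summable_norm:
  assumes "has_expansion F f M"
  shows "summable (\<lambda>k. norm (s ^ k *\<^sub>R fps_nth f k))"
proof (rule summable_comparison_test')
  show "summable (\<lambda>k. (\<bar>s\<bar> * M) ^ k /\<^sub>R fact k)"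
    by (rule summable_exp_generic)
  fix k
  have "\<bar>s\<bar> ^ k * norm (fps_nth f k) \<le> \<bar>s\<bar> ^ k * (M ^ k / fact k)"
    using assms by (intro mult_left_mono) (auto simp: has_expansion_def)
  then show "norm (norm (s ^ k *\<^sub>R fps_nth f k)) \<le> (\<bar>s\<bar> * M) ^ k /\<^sub>R fact k"
    by (simp add: power_abs power_mult_distrib divide_inverse mult_ac)
qed

lemma has_expansion_one: "has_expansion (\<lambda>s. 1) 1 0"
  unfolding has_expansion_def
proof (intro conjI allI)
  fix s :: real
  have "(\<lambda>k. s ^ k *\<^sub>R fps_nth 1 k) = (\<lambda>k. if k = 0 then 1 else 0 :: 'a)"
    by auto
  then show "(\<lambda>k. s ^ k *\<^sub>R fps_nth 1 k) sums (1 :: 'a)"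
    using sums_single [of 0 "\<lambda>k. 1 :: 'a"] by simp
qed auto

lemma has_expansion_exp: "has_expansion (\<lambda>s. exp (s *\<^sub>R A)) (fps_expo A) (norm A)"
  unfolding has_expansion_def
proof (intro conjI allI)
  fix k and s :: real
  have "norm (A ^ k) / fact k \<le> norm A ^ k / fact k"
    by (intro divide_right_mono norm_power_ineq) auto
  then show "norm (fps_nth (fps_expo A) k) \<le> norm A ^ k / fact k"
    by (simp add: divide_inverse mult.commute)
  show "(\<lambda>k. s ^ k *\<^sub>R fps_nth (fps_expo A) k) sums exp (s *\<^sub>R A)"
    using exp_converges [of "s *\<^sub>R A"] by (simp add: mult.commute)
qed simp

lemma has_expansion_dilate:
  assumes "has_expansion F f M"
  shows "has_expansion (\<lambda>s. F (u * s)) (fps_dilate u f) (\<bar>u\<bar> * M)"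
  unfolding has_expansion_def
proof (intro conjI allI)
  fix k and s :: real
  show "0 \<le> \<bar>u\<bar> * M"
    using assms by (simp add: has_expansion_def)
  have "\<bar>u\<bar> ^ k * norm (fps_nth f k) \<le> \<bar>u\<bar> ^ k * (M ^ k / fact k)"
    using assms by (intro mult_left_mono) (auto simp: has_expansion_def)
  then show "norm (fps_nth (fps_dilate u f) k) \<le> (\<bar>u\<bar> * M) ^ k / fact k"
    by (simp add: power_abs power_mult_distrib)
  have "(\<lambda>k. (u * s) ^ k *\<^sub>R fps_nth f k) sums F (u * s)"
    using assms unfolding has_expansion_def by blast
  then show "(\<lambda>k. s ^ k *\<^sub>R fps_nth (fps_dilate u f) k) sums F (u * s)"
    by (simp add: power_mult_distrib mult.commute)
qed

text \<open>By the binomial theorem, the Cauchy product of the majorants with parameters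
  \<open>M\<close> and \<open>N\<close> is the one with parameter \<open>M + N\<close>. Absolute
  convergence justifies multiplying the two series.\<close>

lemma has_expansion_mult:
  assumes F: "has_expansion F f M" and G: "has_expansion G g N"
  shows "has_expansion (\<lambda>s. F s * G s) (f * g) (M + N)"
  unfolding has_expansion_def
proof (intro conjI allI)
  fix k and s :: real
  show "0 \<le> M + N"
    using F G by (simp add: has_expansion_def)
  have "norm (fps_nth (f * g) k) \<le> (\<Sum>i=0..k. norm (fps_nth f i * fps_nth g (k - i)))"
    by (simp add: fps_mult_nth sum_norm_le)
  also have "\<dots> \<le> (\<Sum>i=0..k. norm (fps_nth f i) * norm (fps_nth g (k - i)))"
    by (intro sum_mono norm_mult_ineq)
  also have "\<dots> \<le> (\<Sum>i=0..k. (M ^ i / fact i) * (N ^ (k - i) / fact (k - i)))"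
    using F G by (intro sum_mono mult_mono) (auto simp: has_expansion_def)
  also have "\<dots> = (M + N) ^ k / fact k"
    using exp_series_add_commuting [OF mult.commute [of M N], of k]
    by (simp add: divide_inverse mult_ac atLeast0AtMost)
  finally show "norm (fps_nth (f * g) k) \<le> (M + N) ^ k / fact k" .
  have "(\<lambda>k. \<Sum>i\<le>k. (s ^ i *\<^sub>R fps_nth f i) * (s ^ (k - i) *\<^sub>R fps_nth g (k - i)))
      sums ((\<Sum>k. s ^ k *\<^sub>R fps_nth f k) * (\<Sum>k. s ^ k *\<^sub>R fps_nth g k))"
    by (rule Cauchy_product_sums) (rule has_expansion_summable_norm [OF F] has_expansion_summable_norm [OF G])+
  moreover have "(\<Sum>i\<le>k. (s ^ i *\<^sub>R fps_nth f i) * (s ^ (k - i) *\<^sub>R fps_nth g (k - i)))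
      = s ^ k *\<^sub>R fps_nth (f * g) k" for k
    using arg_cong [OF fps_dilate_mult [of s f g], of "\<lambda>h. fps_nth h k"]
    by (simp add: fps_mult_nth atLeast0AtMost)
  moreover have "(\<Sum>k. s ^ k *\<^sub>R fps_nth f k) = F s" "(\<Sum>k. s ^ k *\<^sub>R fps_nth g k) = G s"
    using F G by (simp_all add: has_expansion_def sums_iff)
  ultimately show "(\<lambda>k. s ^ k *\<^sub>R fps_nth (f * g) k) sums (F s * G s)"
    by simp
qed

lemma has_expansion_prod_list:
  assumes "\<And>x. x \<in> set xs \<Longrightarrow> has_expansion (F x) (f x) (M x)"
  shows "has_expansion (\<lambda>s. prod_list (map (\<lambda>x. F x s) xs)) (prod_list (map f xs)) (sum_list (map M xs))"
  using assms
  by (induction xs) (auto intro: has_expansion_one has_expansion_mult)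

section \<open>Product formulas in a Banach algebra and their error\<close>

definition strang_formula :: "'a::{real_normed_algebra_1,banach} list \<Rightarrow> real \<Rightarrow> 'a"
  where "strang_formula As s = prod_list (map (\<lambda>A. exp ((s / 2) *\<^sub>R A)) As)
    * prod_list (map (\<lambda>A. exp ((s / 2) *\<^sub>R A)) (rev As))"

fun suzuki_formula :: "'a::{real_normed_algebra_1,banach} list \<Rightarrow> nat \<Rightarrow> real \<Rightarrow> 'a"
  where
    "suzuki_formula As 0 s = 1"
  | "suzuki_formula As (Suc 0) s = strang_formula As s"
  | "suzuki_formula As (Suc (Suc q)) s =
      (let u = suzuki_u (Suc (Suc q)) in
        suzuki_formula As (Suc q) (u * s) ^ 2 * suzuki_formula As (Suc q) ((1 - 4 * u) * s)
        * suzuki_formula As (Suc q) (u * s) ^ 2)"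

text \<open>The total evolution time, counted with absolute values, of each term in a unit step.\<close>

fun suzuki_cost :: "nat \<Rightarrow> real"
  where
    "suzuki_cost 0 = 0"
  | "suzuki_cost (Suc 0) = 1"
  | "suzuki_cost (Suc (Suc q)) =
      (4 * \<bar>suzuki_u (Suc (Suc q))\<bar> + \<bar>1 - 4 * suzuki_u (Suc (Suc q))\<bar>) * suzuki_cost (Suc q)"

text \<open>The signed step lengths add up to 1, so their absolute values add up to at least 1.
  Hence the majorant of the product formula also dominates the exact evolution.\<close>

lemma suzuki_cost_ge_1: "1 \<le> suzuki_cost (Suc q)"
proof (induction q)
  case (Suc q)
  have "1 * 1 \<le> (4 * \<bar>suzuki_u (Suc (Suc q))\<bar> + \<bar>1 - 4 * suzuki_u (Suc (Suc q))\<bar>) * suzuki_cost (Suc q)"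
    using Suc by (intro mult_mono) auto
  then show ?case by simp
qed simp

text \<open>Majorant parameters add under products and scale by \<open>\<bar>u\<bar>\<close> under
  dilation, which is the recursion of \<open>suzuki_cost\<close>. In the Strang product each term
  occurs twice, with half its norm.\<close>

lemma has_expansion_suzuki:
  "has_expansion (suzuki_formula As p) (suzuki_fps As p) (suzuki_cost p * sum_list (map norm As))"
proof (induction As p rule: suzuki_fps.induct)
  case (1 As)
  then show ?case by (simp add: has_expansion_one)
next
  case (2 As)
  let ?N = "sum_list (map norm As)"
  have half: "has_expansion (\<lambda>s. exp ((s / 2) *\<^sub>R A)) (fps_expo ((1/2) *\<^sub>R A)) (norm A / 2)" for A :: 'a
    using has_expansion_dilate [OF has_expansion_exp [of A], of "1/2"]
    by (simp add: fps_dilate_expo)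
  have "sum_list (map (\<lambda>A. norm A / 2) (rev As)) = sum_list (map (\<lambda>A. norm A / 2) As)"
    by (metis rev_map sum_mset_sum_list mset_rev)
  moreover have "sum_list (map (\<lambda>A. norm A / 2) As) + sum_list (map (\<lambda>A. norm A / 2) As) = ?N"
    by (induction As) auto
  moreover have "has_expansion (strang_formula As) (strang_fps As)
     (sum_list (map (\<lambda>A. norm A / 2) As) + sum_list (map (\<lambda>A. norm A / 2) (rev As)))"
    unfolding strang_formula_def [abs_def] strang_fps_def
    by (intro has_expansion_mult has_expansion_prod_list half)
  ultimately show ?case by simp
next
  case (3 As q)
  define u where "u = suzuki_u (Suc (Suc q))"
  let ?N = "suzuki_cost (Suc q) * sum_list (map norm As)"
  let ?F = "suzuki_formula As (Suc q)" and ?f = "suzuki_fps As (Suc q)"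
  have IH: "has_expansion ?F ?f ?N"
    by (rule "3.IH") (rule refl)+
  note a = has_expansion_dilate [OF IH, of u]
  note b = has_expansion_dilate [OF IH, of "1 - 4 * u"]
  have "has_expansion (\<lambda>s. (?F (u * s) * ?F (u * s)) * ?F ((1 - 4 * u) * s) * (?F (u * s) * ?F (u * s)))
    ((fps_dilate u ?f * fps_dilate u ?f) * fps_dilate (1 - 4 * u) ?f * (fps_dilate u ?f * fps_dilate u ?f))
    ((\<bar>u\<bar> * ?N + \<bar>u\<bar> * ?N) + \<bar>1 - 4 * u\<bar> * ?N + (\<bar>u\<bar> * ?N + \<bar>u\<bar> * ?N))"
    by (intro has_expansion_mult a b)
  moreover have "(\<bar>u\<bar> * ?N + \<bar>u\<bar> * ?N) + \<bar>1 - 4 * u\<bar> * ?N + (\<bar>u\<bar> * ?N + \<bar>u\<bar> * ?N)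
      = suzuki_cost (Suc (Suc q)) * sum_list (map norm As)"
    by (simp add: u_def algebra_simps)
  ultimately show ?case
    by (simp add: u_def Let_def power2_eq_square suzuki_formula.simps(3) [abs_def])
qed

lemma norm_mult_le_one:
  fixes x y :: "'a::real_normed_algebra_1"
  assumes "norm x \<le> 1" "norm y \<le> 1"
  shows "norm (x * y) \<le> 1"
  using norm_mult_ineq [of x y] mult_mono [OF assms] by simp

text \<open>The middle step \<open>1 - 4 * u\<close> is negative, so the exponentials of the terms
  have to be contractions for both signs of the time.\<close>

lemma norm_suzuki_formula_le_one:
  assumes "\<And>A s. A \<in> set As \<Longrightarrow> norm (exp (s *\<^sub>R A)) \<le> 1"
  shows "norm (suzuki_formula As p s) \<le> 1"
  using assms
proof (induction As p s rule: suzuki_formula.induct)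
  case (2 As s)
  have "norm (prod_list (map (\<lambda>A. exp ((s / 2) *\<^sub>R A)) Bs)) \<le> 1" if "set Bs \<subseteq> set As" for Bs
    using that by (induction Bs) (auto intro: norm_mult_le_one 2)
  then show ?case
    by (simp add: strang_formula_def norm_mult_le_one)
next
  case (3 As q s)
  then show ?case
    by (simp add: Let_def power2_eq_square norm_mult_le_one)
qed simp

text \<open>Telescoping: the factors are replaced one at a time, next to contractions.\<close>

lemma norm_power_diff_le:
  fixes x y :: "'a::real_normed_algebra_1"
  assumes "norm x \<le> 1" "norm y \<le> 1"
  shows "norm (x ^ n - y ^ n) \<le> real n * norm (x - y)"
proof (induction n)
  case (Suc n)
  have "x ^ Suc n - y ^ Suc n = x * (x ^ n - y ^ n) + (x - y) * y ^ n"
    by (simp add: algebra_simps)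
  then have "norm (x ^ Suc n - y ^ Suc n) \<le> norm (x * (x ^ n - y ^ n)) + norm ((x - y) * y ^ n)"
    by (simp add: norm_triangle_ineq)
  also have "\<dots> \<le> norm x * norm (x ^ n - y ^ n) + norm (x - y) * norm (y ^ n)"
    by (intro add_mono norm_mult_ineq)
  also have "\<dots> \<le> 1 * norm (x ^ n - y ^ n) + norm (x - y) * 1"
    using assms order_trans [OF norm_power_ineq power_le_one [of "norm y" n]]
    by (intro add_mono mult_mono) auto
  also have "\<dots> \<le> real n * norm (x - y) + norm (x - y)"
    using Suc by simp
  finally show ?case by (simp add: algebra_simps)
qed simp

lemma suzuki_formula_step_error:
  assumes unit: "\<And>A s. A \<in> set As \<Longrightarrow> norm (exp (s *\<^sub>R A)) \<le> 1"
    and unit': "\<And>s. norm (exp (s *\<^sub>R sum_list As)) \<le> 1"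
    and "0 < p" "0 \<le> s"
  shows "norm (suzuki_formula As p s - exp (s *\<^sub>R sum_list As))
    \<le> 2 * exp (suzuki_cost p) * (sum_list (map norm As) * s) ^ (2 * p + 1)"
proof -
  define L c where "L = sum_list (map norm As)" and "c = suzuki_cost p"
  have "1 \<le> c" using suzuki_cost_ge_1 [of "p - 1"] \<open>0 < p\<close> by (simp add: c_def)
  have "0 \<le> L" unfolding L_def by (rule sum_list_nonneg) auto
  show ?thesis
  proof (cases "L * s \<le> 1")
    \<comment> \<open>Two contractions are at distance at most 2, and the other factors on the
      right-hand side are at least 1.\<close>
    case False
    have "norm (suzuki_formula As p s - exp (s *\<^sub>R sum_list As)) \<le> 1 + 1"
      using norm_triangle_ineq4 norm_suzuki_formula_le_one [OF unit] unit'
      by (meson add_mono order_trans)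
    moreover have "1 \<le> (L * s) ^ (2 * p + 1)"
      using False by (intro one_le_power) simp
    then have "1 + 1 \<le> 2 * (exp c * (L * s) ^ (2 * p + 1))"
      using mult_mono [of 1 "exp c" 1 "(L * s) ^ (2 * p + 1)"] \<open>1 \<le> c\<close> by simp
    ultimately show ?thesis by (simp add: L_def c_def mult.assoc)
  next
    case True
    define d where "d k = fps_nth (suzuki_fps As p) k - fps_nth (fps_expo (sum_list As)) k" for k
    have S: "has_expansion (suzuki_formula As p) (suzuki_fps As p) (c * L)"
      unfolding c_def L_def by (rule has_expansion_suzuki)
    have E: "has_expansion (\<lambda>s. exp (s *\<^sub>R sum_list As)) (fps_expo (sum_list As)) (norm (sum_list As))"
      by (rule has_expansion_exp)
    have "norm (sum_list As) \<le> L"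
      unfolding L_def by (induction As) (auto intro: norm_triangle_le)
    \<comment> \<open>This makes \<open>c * L\<close> a common majorant parameter for the product
      formula and the exact evolution.\<close>
    also have "L \<le> c * L"
      using mult_right_mono [OF \<open>1 \<le> c\<close> \<open>0 \<le> L\<close>] by simp
    finally have "norm (sum_list As) ^ k / fact k \<le> (c * L) ^ k / fact k" for k
      by (intro divide_right_mono power_mono) auto
    then have "norm (fps_nth (fps_expo (sum_list As)) k) \<le> (c * L) ^ k / fact k" for k
      using E unfolding has_expansion_def by (meson order_trans)
    moreover have "norm (fps_nth (suzuki_fps As p) k) \<le> (c * L) ^ k / fact k" for k
      using S unfolding has_expansion_def by blast
    ultimately have d_le: "norm (d k) \<le> (c * L) ^ k / fact k + (c * L) ^ k / fact k" for k
      unfolding d_def by (meson add_mono norm_triangle_ineq4 order_trans)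
    have d_zero: "d k = 0" if "k < 2 * p + 1" for k
      using suzuki_fps_order [OF \<open>0 < p\<close>, of As] that by (simp add: d_def agree_below_def)
    \<comment> \<open>Orders below \<open>2 * p + 1\<close> cancel. From there on
      \<open>L * s \<le> 1\<close> bounds \<open>(L * s) ^ k\<close> by
      \<open>(L * s) ^ (2 * p + 1)\<close>, and what remains of each of the two majorants sums to
      \<open>exp c\<close>.\<close>
    have bound: "norm (s ^ k *\<^sub>R d k) \<le> (2 * (L * s) ^ (2 * p + 1)) * (c ^ k /\<^sub>R fact k)" for k
    proof (cases "k < 2 * p + 1")
      case True
      then show ?thesis
        using d_zero \<open>0 \<le> L\<close> \<open>0 \<le> s\<close> \<open>1 \<le> c\<close> by simp
    next
      case False
      have "norm (s ^ k *\<^sub>R d k) \<le> s ^ k * ((c * L) ^ k / fact k + (c * L) ^ k / fact k)"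
        using mult_left_mono [OF d_le, of "s ^ k" k] \<open>0 \<le> s\<close> by simp
      also have "\<dots> = 2 * (L * s) ^ k * (c ^ k / fact k)"
        by (simp add: power_mult_distrib)
      also have "\<dots> \<le> 2 * (L * s) ^ (2 * p + 1) * (c ^ k / fact k)"
        using False \<open>L * s \<le> 1\<close> \<open>0 \<le> L\<close> \<open>0 \<le> s\<close> \<open>1 \<le> c\<close>
        by (intro mult_right_mono mult_left_mono power_decreasing) auto
      finally show ?thesis by (simp add: divide_inverse mult.commute)
    qed
    have maj: "(\<lambda>k. (2 * (L * s) ^ (2 * p + 1)) * (c ^ k /\<^sub>R fact k))
        sums ((2 * (L * s) ^ (2 * p + 1)) * exp c)"
      by (intro sums_mult exp_converges)
    have "(\<lambda>k. s ^ k *\<^sub>R fps_nth (suzuki_fps As p) k - s ^ k *\<^sub>R fps_nth (fps_expo (sum_list As)) k)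
        sums (suzuki_formula As p s - exp (s *\<^sub>R sum_list As))"
      using S E unfolding has_expansion_def by (intro sums_diff) blast+
    then have "(\<lambda>k. s ^ k *\<^sub>R d k) sums (suzuki_formula As p s - exp (s *\<^sub>R sum_list As))"
      by (simp add: d_def scaleR_diff_right)
    then have "norm (suzuki_formula As p s - exp (s *\<^sub>R sum_list As)) = norm (\<Sum>k. s ^ k *\<^sub>R d k)"
      by (simp add: sums_iff)
    also have "\<dots> \<le> (\<Sum>k. (2 * (L * s) ^ (2 * p + 1)) * (c ^ k /\<^sub>R fact k))"
      using maj bound by (intro norm_suminf_le) (auto dest: sums_summable)
    also have "\<dots> = (2 * (L * s) ^ (2 * p + 1)) * exp c"
      using maj by (simp add: sums_iff)
    finally show ?thesis by (simp add: L_def c_def mult_ac)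
  qed
qed

lemma exp_scaleR_of_nat:
  fixes x :: "'a::{real_normed_algebra_1,banach}"
  shows "exp (real n *\<^sub>R x) = exp x ^ n"
proof (induction n)
  case (Suc n)
  have "exp (x + real n *\<^sub>R x) = exp x * exp (real n *\<^sub>R x)"
    by (rule exp_add_commuting) simp
  with Suc show ?case by (simp add: scaleR_add_left)
qed simp

text \<open>The errors of the \<open>N\<close> steps add, and \<open>N\<close> times
  \<open>(t / N) ^ (2 * p + 1)\<close> leaves \<open>N ^ (2 * p)\<close> in the denominator.\<close>

lemma suzuki_formula_error:
  assumes unit: "\<And>A s. A \<in> set As \<Longrightarrow> norm (exp (s *\<^sub>R A)) \<le> 1"
    and unit': "\<And>s. norm (exp (s *\<^sub>R sum_list As)) \<le> 1"
    and "0 < p" "0 < N" "0 \<le> t"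
  shows "norm (suzuki_formula As p (t / real N) ^ N - exp (t *\<^sub>R sum_list As))
    \<le> 2 * exp (suzuki_cost p) * (sum_list (map norm As) ^ (2 * p + 1) * t ^ (2 * p + 1) / real N ^ (2 * p))"
proof -
  let ?L = "sum_list (map norm As)"
  have "exp (t *\<^sub>R sum_list As) = exp ((t / real N) *\<^sub>R sum_list As) ^ N"
    using exp_scaleR_of_nat [of N "(t / real N) *\<^sub>R sum_list As"] \<open>0 < N\<close> by simp
  then have "norm (suzuki_formula As p (t / real N) ^ N - exp (t *\<^sub>R sum_list As))
    \<le> real N * norm (suzuki_formula As p (t / real N) - exp ((t / real N) *\<^sub>R sum_list As))"
    using norm_power_diff_le [OF norm_suzuki_formula_le_one [OF unit] unit'] by simp
  also have "\<dots> \<le> real N * (2 * exp (suzuki_cost p) * (?L * (t / real N)) ^ (2 * p + 1))"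
    using assms by (intro mult_left_mono suzuki_formula_step_error) auto
  also have "\<dots> = 2 * exp (suzuki_cost p) * (?L ^ (2 * p + 1) * t ^ (2 * p + 1) / real N ^ (2 * p))"
    using \<open>0 < N\<close> by (simp add: power_mult_distrib power_divide)
  finally show ?thesis .
qed

section \<open>The operator norm\<close>

lemma vec_norm2_nonneg [simp]: "0 \<le> vec_norm2 v"
  by (simp add: vec_norm2_def)

lemma vec_norm2_smult: "vec_norm2 (c \<cdot>\<^sub>v v) = cmod c * vec_norm2 v"
  by (simp add: vec_norm2_def norm_mult L2_set_right_distrib cong: L2_set_cong_simp)

lemma vec_norm2_triangle:
  assumes "v \<in> carrier_vec n" "w \<in> carrier_vec n"
  shows "vec_norm2 (v + w) \<le> vec_norm2 v + vec_norm2 w"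
proof -
  have "vec_norm2 (v + w) = L2_set (\<lambda>x. cmod (v $ x + w $ x)) {..<n}"
    unfolding vec_norm2_def using assms by (intro L2_set_cong) auto
  also have "\<dots> \<le> L2_set (\<lambda>x. cmod (v $ x) + cmod (w $ x)) {..<n}"
    by (intro L2_set_mono norm_triangle_ineq) auto
  also have "\<dots> \<le> vec_norm2 v + vec_norm2 w"
    using assms unfolding vec_norm2_def by (metis L2_set_triangle_ineq carrier_vecD)
  finally show ?thesis .
qed

lemma cmod_index_le_vec_norm2: "x < dim_vec v \<Longrightarrow> cmod (v $ x) \<le> vec_norm2 v"
  unfolding vec_norm2_def by (rule member_le_L2_set) auto

lemma vec_norm2_unit: "y < n \<Longrightarrow> vec_norm2 (unit_vec n y) = 1"
proof -
  assume "y < n"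
  have "(\<Sum>x<n. (cmod (unit_vec n y $ x))\<^sup>2) = (\<Sum>x<n. if x = y then 1 else 0)"
    using \<open>y < n\<close> by (intro sum.cong) auto
  with \<open>y < n\<close> show ?thesis by (simp add: vec_norm2_def L2_set_def)
qed

text \<open>A crude bound whose purpose is to show that the set in \<open>op_norm\<close> is bounded
  above, so that its \<open>Sup\<close> is a genuine supremum.\<close>

lemma vec_norm2_mult_le_sum:
  assumes "A \<in> carrier_mat m n" "v \<in> carrier_vec n"
  shows "vec_norm2 (A *\<^sub>v v) \<le> (\<Sum>x<m. \<Sum>y<n. cmod (A $$ (x, y))) * vec_norm2 v"
proof -
  have "vec_norm2 (A *\<^sub>v v) \<le> (\<Sum>x<m. cmod ((A *\<^sub>v v) $ x))"
    unfolding vec_norm2_def using assms L2_set_le_sum [of "{..<m}" "\<lambda>x. cmod ((A *\<^sub>v v) $ x)"]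
    by auto
  also have "\<dots> \<le> (\<Sum>x<m. \<Sum>y<n. cmod (A $$ (x, y)) * vec_norm2 v)"
  proof (rule sum_mono)
    fix x assume "x \<in> {..<m}"
    then have "(A *\<^sub>v v) $ x = (\<Sum>y<n. A $$ (x, y) * v $ y)"
      using assms by (auto simp: scalar_prod_def atLeast0LessThan intro!: sum.cong)
    also have "cmod \<dots> \<le> (\<Sum>y<n. cmod (A $$ (x, y)) * vec_norm2 v)"
      using assms by (intro sum_norm_le)
        (auto simp: norm_mult intro!: mult_left_mono cmod_index_le_vec_norm2)
    finally show "cmod ((A *\<^sub>v v) $ x) \<le> (\<Sum>y<n. cmod (A $$ (x, y)) * vec_norm2 v)" .
  qed
  finally show ?thesis by (simp add: sum_distrib_right)
qed

lemma vec_norm2_mult_le_op_norm: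
  assumes A: "A \<in> carrier_mat m n" and v: "v \<in> carrier_vec n"
  shows "vec_norm2 (A *\<^sub>v v) \<le> op_norm A * vec_norm2 v"
proof (cases "vec_norm2 v = 0")
  case True
  then show ?thesis
    using vec_norm2_mult_le_sum [OF A v] by simp
next
  case False
  define w where "w = complex_of_real (1 / vec_norm2 v) \<cdot>\<^sub>v v"
  have w: "w \<in> carrier_vec n" "vec_norm2 w = 1"
    using v False by (simp_all add: w_def vec_norm2_smult norm_divide)
  have "bdd_above {vec_norm2 (A *\<^sub>v v) |v. v \<in> carrier_vec (dim_col A) \<and> vec_norm2 v = 1}"
    using vec_norm2_mult_le_sum [OF A] A by (auto intro!: bdd_aboveI) fastforce
  then have "vec_norm2 (A *\<^sub>v w) \<le> op_norm A"
    unfolding op_norm_def using w A by (intro cSup_upper) auto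
  moreover have "v = complex_of_real (vec_norm2 v) \<cdot>\<^sub>v w"
    using False by (simp add: w_def smult_smult_assoc)
  then have "vec_norm2 (A *\<^sub>v v) = vec_norm2 v * vec_norm2 (A *\<^sub>v w)"
    using mult_mat_vec [OF A w(1)] by (metis abs_of_nonneg norm_of_real vec_norm2_nonneg vec_norm2_smult)
  ultimately show ?thesis
    by (metis mult.commute mult_left_mono vec_norm2_nonneg)
qed

text \<open>\<open>0 < n\<close> supplies a vector of norm 1; the \<open>Sup\<close> of an empty set
  would carry no information.\<close>

lemma op_norm_le:
  assumes A: "A \<in> carrier_mat m n" and "0 < n"
    and "\<And>v. v \<in> carrier_vec n \<Longrightarrow> vec_norm2 v = 1 \<Longrightarrow> vec_norm2 (A *\<^sub>v v) \<le> C"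
  shows "op_norm A \<le> C"
  unfolding op_norm_def using assms vec_norm2_unit [OF \<open>0 < n\<close>]
  by (intro cSup_least) (auto intro!: exI [of _ "unit_vec n 0"])

lemma op_norm_nonneg:
  assumes "A \<in> carrier_mat m n" "0 < n"
  shows "0 \<le> op_norm A"
  using vec_norm2_mult_le_op_norm [OF assms(1), of "unit_vec n 0"] vec_norm2_unit [OF assms(2)]
  by (metis mult.right_neutral order_trans unit_vec_carrier vec_norm2_nonneg)

text \<open>A column is the image of a unit vector. The bound yields definiteness of the norm and
  continuity of the entries.\<close>

lemma cmod_index_le_op_norm:
  assumes A: "A \<in> carrier_mat m n" and "x < m" "y < n"
  shows "cmod (A $$ (x, y)) \<le> op_norm A"
proof -
  have "A $$ (x, y) = (A *\<^sub>v unit_vec n y) $ x"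
    using assms by simp
  then have "cmod (A $$ (x, y)) \<le> vec_norm2 (A *\<^sub>v unit_vec n y)"
    using assms by (metis carrier_matD(1) cmod_index_le_vec_norm2 dim_mult_mat_vec)
  also have "\<dots> \<le> op_norm A"
    using vec_norm2_mult_le_op_norm [OF A, of "unit_vec n y"] vec_norm2_unit [OF \<open>y < n\<close>] by simp
  finally show ?thesis .
qed

lemma op_norm_add_le:
  assumes A: "A \<in> carrier_mat m n" and B: "B \<in> carrier_mat m n" and "0 < n"
  shows "op_norm (A + B) \<le> op_norm A + op_norm B"
proof (rule op_norm_le)
  fix v :: "complex Matrix.vec" assume v: "v \<in> carrier_vec n" "vec_norm2 v = 1"
  have "vec_norm2 ((A + B) *\<^sub>v v) \<le> vec_norm2 (A *\<^sub>v v) + vec_norm2 (B *\<^sub>v v)"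
    using A B v by (simp add: add_mult_distrib_mat_vec vec_norm2_triangle [of _ m])
  also have "\<dots> \<le> op_norm A + op_norm B"
    using vec_norm2_mult_le_op_norm [OF A v(1)] vec_norm2_mult_le_op_norm [OF B v(1)] v(2) by simp
  finally show "vec_norm2 ((A + B) *\<^sub>v v) \<le> op_norm A + op_norm B" .
qed (use assms in auto)

lemma op_norm_mult_le:
  assumes A: "A \<in> carrier_mat l m" and B: "B \<in> carrier_mat m n" and "0 < m" "0 < n"
  shows "op_norm (A * B) \<le> op_norm A * op_norm B"
proof (rule op_norm_le)
  fix v :: "complex Matrix.vec" assume v: "v \<in> carrier_vec n" "vec_norm2 v = 1"
  have "vec_norm2 ((A * B) *\<^sub>v v) \<le> op_norm A * vec_norm2 (B *\<^sub>v v)"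
    using A B v by (simp add: vec_norm2_mult_le_op_norm [OF A])
  also have "\<dots> \<le> op_norm A * op_norm B"
    using vec_norm2_mult_le_op_norm [OF B v(1)] v(2) op_norm_nonneg [OF A \<open>0 < m\<close>]
    by (simp add: mult_left_mono)
  finally show "vec_norm2 ((A * B) *\<^sub>v v) \<le> op_norm A * op_norm B" .
qed (use assms in auto)

lemma op_norm_smult_le:
  assumes A: "A \<in> carrier_mat m n" and "0 < n"
  shows "op_norm (c \<cdot>\<^sub>m A) \<le> cmod c * op_norm A"
proof (rule op_norm_le)
  fix v :: "complex Matrix.vec" assume v: "v \<in> carrier_vec n" "vec_norm2 v = 1"
  have "(c \<cdot>\<^sub>m A) *\<^sub>v v = c \<cdot>\<^sub>v (A *\<^sub>v v)"
    using A v by (intro eq_vecI) auto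
  then show "vec_norm2 ((c \<cdot>\<^sub>m A) *\<^sub>v v) \<le> cmod c * op_norm A"
    using vec_norm2_mult_le_op_norm [OF A v(1)] v(2) by (simp add: vec_norm2_smult mult_left_mono)
qed (use assms in auto)

lemma op_norm_smult:
  assumes A: "A \<in> carrier_mat m n" and "0 < n"
  shows "op_norm (c \<cdot>\<^sub>m A) = cmod c * op_norm A"
proof (cases "c = 0")
  case True
  with op_norm_smult_le [OF assms, of c] op_norm_nonneg [of "c \<cdot>\<^sub>m A" m n] assms show ?thesis by simp
next
  case False
  \<comment> \<open>The upper bound for the inverse scalar gives the lower bound for
    \<open>c\<close>.\<close>
  have "op_norm (inverse c \<cdot>\<^sub>m (c \<cdot>\<^sub>m A)) \<le> cmod (inverse c) * op_norm (c \<cdot>\<^sub>m A)"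
    using assms by (intro op_norm_smult_le) auto
  moreover have "inverse c \<cdot>\<^sub>m (c \<cdot>\<^sub>m A) = A"
    using False by (intro eq_matI) auto
  ultimately have "cmod c * op_norm A \<le> op_norm (c \<cdot>\<^sub>m A)"
    using False by (simp add: norm_divide field_simps)
  with op_norm_smult_le [OF assms, of c] show ?thesis by simp
qed

lemma op_norm_one: "0 < n \<Longrightarrow> op_norm (1\<^sub>m n) = 1"
proof (rule antisym)
  assume "0 < n"
  then show "op_norm (1\<^sub>m n) \<le> 1" by (intro op_norm_le [of _ n n]) auto
  show "1 \<le> op_norm (1\<^sub>m n)"
    using cmod_index_le_op_norm [of "1\<^sub>m n" n n 0 0] \<open>0 < n\<close> by simp
qed

lemma op_norm_zero: "0 < n \<Longrightarrow> op_norm (0\<^sub>m n n) = 0"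
proof -
  assume "0 < n"
  have "0 \<cdot>\<^sub>m 1\<^sub>m n = (0\<^sub>m n n :: complex mat)" by (intro eq_matI) auto
  with op_norm_smult [of "1\<^sub>m n" n n 0] \<open>0 < n\<close> show ?thesis by simp
qed

lemma op_norm_eq_0D:
  assumes "A \<in> carrier_mat m n" "op_norm A = 0"
  shows "A = 0\<^sub>m m n"
proof (rule eq_matI)
  fix x y assume "x < dim_row (0\<^sub>m m n)" "y < dim_col (0\<^sub>m m n)"
  then show "A $$ (x, y) = 0\<^sub>m m n $$ (x, y)"
    using cmod_index_le_op_norm [OF assms(1), of x y] assms(2) by simp
qed (use assms in auto)

section \<open>A Banach algebra of block-diagonal operators\<close>

text \<open>
  Operators of every dimension \<open>2 ^ n\<close> are placed in one type, so that the exponential and the error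
  bound for Banach algebras apply to matrices whose dimension is a variable: projecting to the
  \<open>n\<close>-th block is a unital homomorphism, and filling the other blocks with zeros is isometric.
\<close>

typedef block_op = "{f :: nat \<Rightarrow> complex mat.
    (\<forall>n. f n \<in> carrier_mat (fock_dim n) (fock_dim n)) \<and> bdd_above (range (\<lambda>n. op_norm (f n)))}"
  morphisms block Block
  by (intro exI [of _ "\<lambda>n. 1\<^sub>m (fock_dim n)"]) (simp add: op_norm_one)

setup_lifting type_definition_block_op

lemma block_carrier [simp, intro]: "block f n \<in> carrier_mat (fock_dim n) (fock_dim n)"
  using block [of f] by simp

lemma block_dim [simp]: "dim_row (block f n) = fock_dim n" "dim_col (block f n) = fock_dim n"
  using block_carrier by blast+

lemma bdd_above_block: "bdd_above (range (\<lambda>n. op_norm (block f n)))"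
  using block [of f] by simp

lemma block_eqI: "(\<And>n. block f n = block g n) \<Longrightarrow> f = g"
  by (metis block_inverse ext)

lemma bdd_above_op_norm_add:
  assumes "\<And>n. f n \<in> carrier_mat (fock_dim n) (fock_dim n)"
    "\<And>n. g n \<in> carrier_mat (fock_dim n) (fock_dim n)"
    "bdd_above (range (\<lambda>n. op_norm (f n)))" "bdd_above (range (\<lambda>n. op_norm (g n)))"
  shows "bdd_above (range (\<lambda>n. op_norm (f n + g n)))"
proof -
  obtain F G where "\<And>n. op_norm (f n) \<le> F" "\<And>n. op_norm (g n) \<le> G"
    using assms(3,4) by (auto simp: bdd_above_def)
  then have bnd: "op_norm (f n + g n) \<le> F + G" for n
    using op_norm_add_le [OF assms(1,2)] by (smt (verit) zero_less_numeral zero_less_power)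
  show ?thesis by (rule bdd_aboveI2) (rule bnd)
qed

lemma bdd_above_op_norm_mult:
  assumes "\<And>n. f n \<in> carrier_mat (fock_dim n) (fock_dim n)"
    "\<And>n. g n \<in> carrier_mat (fock_dim n) (fock_dim n)"
    "bdd_above (range (\<lambda>n. op_norm (f n)))" "bdd_above (range (\<lambda>n. op_norm (g n)))"
  shows "bdd_above (range (\<lambda>n. op_norm (f n * g n)))"
proof -
  obtain F G where FG: "\<And>n. op_norm (f n) \<le> F" "\<And>n. op_norm (g n) \<le> G"
    using assms(3,4) by (auto simp: bdd_above_def)
  have pos: "0 \<le> op_norm (f n)" "0 \<le> op_norm (g n)" for n
    using op_norm_nonneg [OF assms(1)] op_norm_nonneg [OF assms(2)] by simp_all
  have bnd: "op_norm (f n * g n) \<le> F * G" for n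
    using op_norm_mult_le [OF assms(1,2), of n] mult_mono [OF FG(1) FG(2), of n n] pos[of n]
      order_trans [OF pos(1) FG(1)] by fastforce
  show ?thesis by (rule bdd_aboveI2) (rule bnd)
qed

lemma bdd_above_op_norm_smult:
  assumes "\<And>n. f n \<in> carrier_mat (fock_dim n) (fock_dim n)"
    "bdd_above (range (\<lambda>n. op_norm (f n)))"
  shows "bdd_above (range (\<lambda>n. op_norm (c \<cdot>\<^sub>m f n)))"
proof -
  obtain F where F: "\<And>n. op_norm (f n) \<le> F"
    using assms(2) by (auto simp: bdd_above_def)
  have bnd: "op_norm (c \<cdot>\<^sub>m f n) \<le> cmod c * F" for n
    using op_norm_smult [OF assms(1)] mult_left_mono [OF F] by simp
  show ?thesis by (rule bdd_aboveI2) (rule bnd)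
qed

lemma uminus_mat_eq_smult: "- A = (- 1) \<cdot>\<^sub>m (A :: complex mat)"
  by (intro eq_matI) auto

instantiation block_op :: real_normed_algebra_1
begin

lift_definition zero_block_op :: block_op is "\<lambda>n. 0\<^sub>m (fock_dim n) (fock_dim n)"
  by (simp add: op_norm_zero)

lift_definition one_block_op :: block_op is "\<lambda>n. 1\<^sub>m (fock_dim n)"
  by (simp add: op_norm_one)

lift_definition plus_block_op :: "block_op \<Rightarrow> block_op \<Rightarrow> block_op" is "\<lambda>f g n. f n + g n"
  by (simp add: bdd_above_op_norm_add)

lift_definition uminus_block_op :: "block_op \<Rightarrow> block_op" is "\<lambda>f n. - f n"
  using bdd_above_op_norm_smult [of _ "- 1"] by (simp add: uminus_mat_eq_smult)

lift_definition times_block_op :: "block_op \<Rightarrow> block_op \<Rightarrow> block_op" is "\<lambda>f g n. f n * g n"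
  by (auto intro!: bdd_above_op_norm_mult mult_carrier_mat [of _ n n for n])

lift_definition scaleR_block_op :: "real \<Rightarrow> block_op \<Rightarrow> block_op"
  is "\<lambda>c f n. complex_of_real c \<cdot>\<^sub>m f n"
  by (simp add: bdd_above_op_norm_smult)

definition minus_block_op :: "block_op \<Rightarrow> block_op \<Rightarrow> block_op"
  where "minus_block_op f g = f + - g"

definition norm_block_op :: "block_op \<Rightarrow> real"
  where "norm_block_op f = (SUP n. op_norm (block f n))"

definition dist_block_op :: "block_op \<Rightarrow> block_op \<Rightarrow> real"
  where "dist_block_op f g = norm (f - g)"

definition sgn_block_op :: "block_op \<Rightarrow> block_op"
  where "sgn_block_op f = inverse (norm f) *\<^sub>R f"

definition uniformity_block_op :: "(block_op \<times> block_op) filter"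
  where "uniformity_block_op = (INF e\<in>{0<..}. principal {(f, g). dist f g < e})"

definition open_block_op :: "block_op set \<Rightarrow> bool"
  where "open_block_op U \<longleftrightarrow> (\<forall>f\<in>U. eventually (\<lambda>(f', g). f' = f \<longrightarrow> g \<in> U) uniformity)"

lemma op_norm_block_le: "op_norm (block f n) \<le> norm f"
  unfolding norm_block_op_def by (rule cSUP_upper [OF _ bdd_above_block]) simp

lemma norm_block_op_le: "(\<And>n. op_norm (block f n) \<le> C) \<Longrightarrow> norm f \<le> C"
  unfolding norm_block_op_def by (rule cSUP_least) auto

lemma op_norm_block_nonneg: "0 \<le> op_norm (block f n)"
  by (rule op_norm_nonneg) auto

instance
proof
  fix f g h :: block_op and a b :: real
  show "f + g + h = f + (g + h)" "f + g = g + f" "0 + f = f" "- f + f = 0"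
    by (rule block_eqI; simp add: plus_block_op.rep_eq zero_block_op.rep_eq uminus_block_op.rep_eq
        assoc_add_mat [OF block_carrier block_carrier block_carrier] comm_add_mat [OF block_carrier block_carrier]
        uminus_l_inv_mat [OF block_carrier])+
  show "f - g = f + - g" by (simp add: minus_block_op_def)
  show "a *\<^sub>R (f + g) = a *\<^sub>R f + a *\<^sub>R g" "(a + b) *\<^sub>R f = a *\<^sub>R f + b *\<^sub>R f"
    "a *\<^sub>R b *\<^sub>R f = (a * b) *\<^sub>R f" "1 *\<^sub>R f = f"
    by (rule block_eqI; simp add: plus_block_op.rep_eq scaleR_block_op.rep_eq;
        intro eq_matI; simp add: algebra_simps)+
  show "f * g * h = f * (g * h)" "1 * f = f" "f * 1 = f"
    by (rule block_eqI; simp add: times_block_op.rep_eq one_block_op.rep_eq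
        assoc_mult_mat [OF block_carrier block_carrier block_carrier]
        left_mult_one_mat [OF block_carrier] right_mult_one_mat [OF block_carrier])+
  show "(f + g) * h = f * h + g * h" "f * (g + h) = f * g + f * h"
    by (rule block_eqI; simp add: plus_block_op.rep_eq times_block_op.rep_eq
        add_mult_distrib_mat [OF block_carrier block_carrier block_carrier]
        mult_add_distrib_mat [OF block_carrier block_carrier block_carrier])+
  show "a *\<^sub>R f * g = a *\<^sub>R (f * g)" "f * a *\<^sub>R g = a *\<^sub>R (f * g)"
    by (rule block_eqI; simp add: scaleR_block_op.rep_eq times_block_op.rep_eq
        mult_smult_assoc_mat [OF block_carrier block_carrier]
        mult_smult_distrib [OF block_carrier block_carrier])+
  show "(0::block_op) \<noteq> 1"
  proof
    assume "(0::block_op) = 1"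
    \<comment> \<open>Block \<open>0\<close> has dimension \<open>2 ^ 0 = 1\<close>; there zero and
      identity differ in their only entry.\<close>
    then have "(0\<^sub>m 1 1 :: complex mat) $$ (0, 0) = 1\<^sub>m 1 $$ (0, 0)"
      by (metis one_block_op.rep_eq power_0 zero_block_op.rep_eq)
    then show False by simp
  qed
  show "dist f g = norm (f - g)" by (simp add: dist_block_op_def)
  show "sgn f = inverse (norm f) *\<^sub>R f" by (simp add: sgn_block_op_def)
  show "uniformity = (INF e\<in>{0<..}. principal {(f, g). dist f (g::block_op) < e})"
    by (simp add: uniformity_block_op_def)
  show "open U \<longleftrightarrow> (\<forall>f\<in>U. eventually (\<lambda>(f', g). f' = f \<longrightarrow> g \<in> U) uniformity)" for U :: "block_op set"
    by (simp add: open_block_op_def)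
  have "block f n = 0\<^sub>m (fock_dim n) (fock_dim n)" if "norm f = 0" for n
    using op_norm_block_le [of f n] op_norm_block_nonneg [of f n] that
    by (intro op_norm_eq_0D) auto
  then have "f = 0" if "norm f = 0"
    using that by (intro block_eqI) (simp add: zero_block_op.rep_eq)
  moreover have "norm (0::block_op) = 0"
    by (simp add: norm_block_op_def zero_block_op.rep_eq op_norm_zero)
  ultimately show "norm f = 0 \<longleftrightarrow> f = 0" by auto
  show "norm (f + g) \<le> norm f + norm g"
  proof (rule norm_block_op_le)
    fix n
    have "op_norm (block (f + g) n) \<le> op_norm (block f n) + op_norm (block g n)"
      unfolding plus_block_op.rep_eq by (rule op_norm_add_le) auto
    also have "\<dots> \<le> norm f + norm g" by (intro add_mono op_norm_block_le)
    finally show "op_norm (block (f + g) n) \<le> norm f + norm g" .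
  qed
  show "norm (a *\<^sub>R f) = \<bar>a\<bar> * norm f"
  proof -
    have le: "norm (a *\<^sub>R f) \<le> \<bar>a\<bar> * norm f" for a and f :: block_op
      by (rule norm_block_op_le)
        (simp add: scaleR_block_op.rep_eq op_norm_smult [OF block_carrier] mult_left_mono op_norm_block_le)
    show ?thesis
    proof (cases "a = 0")
      case True
      with le [of a f] show ?thesis
        using op_norm_block_le [of "a *\<^sub>R f" 0] op_norm_block_nonneg [of "a *\<^sub>R f" 0] by simp
    next
      case False
      have "inverse a *\<^sub>R (a *\<^sub>R f) = f"
        using False by (intro block_eqI eq_matI) (simp_all add: scaleR_block_op.rep_eq)
      then have "norm f \<le> \<bar>inverse a\<bar> * norm (a *\<^sub>R f)" using le by metis
      then show ?thesis using le [of a f] False by (simp add: field_simps)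
    qed
  qed
  show "norm (f * g) \<le> norm f * norm g"
  proof (rule norm_block_op_le)
    fix n
    have "op_norm (block (f * g) n) \<le> op_norm (block f n) * op_norm (block g n)"
      unfolding times_block_op.rep_eq by (rule op_norm_mult_le) auto
    also have "\<dots> \<le> norm f * norm g"
      using op_norm_block_nonneg op_norm_block_le order_trans by (intro mult_mono) blast+
    finally show "op_norm (block (f * g) n) \<le> norm f * norm g" .
  qed
  show "norm (1::block_op) = 1"
    by (simp add: norm_block_op_def one_block_op.rep_eq op_norm_one)
qed

end

lemma block_zero: "block 0 n = 0\<^sub>m (fock_dim n) (fock_dim n)"
  by (simp add: zero_block_op.rep_eq)

lemma block_one: "block 1 n = 1\<^sub>m (fock_dim n)"
  by (simp add: one_block_op.rep_eq)

lemma block_add: "block (f + g) n = block f n + block g n"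
  by (simp add: plus_block_op.rep_eq)

lemma block_diff: "block (f - g) n = block f n - block g n"
  unfolding minus_block_op_def plus_block_op.rep_eq uminus_block_op.rep_eq
  by (intro eq_matI) auto

lemma block_mult: "block (f * g) n = block f n * block g n"
  by (simp add: times_block_op.rep_eq)

lemma block_scaleR: "block (c *\<^sub>R f) n = complex_of_real c \<cdot>\<^sub>m block f n"
  by (simp add: scaleR_block_op.rep_eq)

lemma block_power: "block (f ^ k) n = block f n ^\<^sub>m k"
proof (induction k)
  case (Suc k)
  then show ?case by (simp add: block_mult power_Suc2 del: power_Suc)
qed (simp add: block_one)

text \<open>Limits and series in \<open>block_op\<close> can therefore be read off entry by
  entry.\<close>

lemma block_entry_bounded_linear:
  assumes "x < fock_dim n" "y < fock_dim n"
  shows "bounded_linear (\<lambda>f. block f n $$ (x, y))"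
proof (rule bounded_linear_intro [of _ 1])
  fix f g :: block_op and c :: real
  show "block (f + g) n $$ (x, y) = block f n $$ (x, y) + block g n $$ (x, y)"
    using assms by (simp add: block_add)
  show "block (c *\<^sub>R f) n $$ (x, y) = c *\<^sub>R block f n $$ (x, y)"
    using assms by (simp add: block_scaleR scaleR_conv_of_real [where 'a = complex])
  show "norm (block f n $$ (x, y)) \<le> norm f * 1"
    using cmod_index_le_op_norm [OF block_carrier assms, of f] op_norm_block_le [of f n] by simp
qed

text \<open>The limit is formed entrywise. A Cauchy estimate holds in all blocks with the same bound
  and survives the entrywise limit, because the norm of the image of a fixed vector depends
  continuously on the finitely many entries of a block.\<close>

instance block_op :: banach
proof
  fix X :: "nat \<Rightarrow> block_op" assume X: "Cauchy X"
  define l where "l n x y = lim (\<lambda>k. block (X k) n $$ (x, y))" for n x y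
  define L where "L n = Matrix.mat (fock_dim n) (fock_dim n) (\<lambda>(x, y). l n x y)" for n
  have L_carrier: "L n \<in> carrier_mat (fock_dim n) (fock_dim n)" for n by (simp add: L_def)
  have lim: "(\<lambda>k. block (X k) n $$ (x, y)) \<longlonglongrightarrow> L n $$ (x, y)" if "x < fock_dim n" "y < fock_dim n" for n x y
    using bounded_linear.Cauchy [OF block_entry_bounded_linear [OF that] X] that
    by (simp add: L_def l_def Cauchy_convergent_iff convergent_LIMSEQ_iff)
  \<comment> \<open>The bound \<open>e\<close> is the same for all blocks. It shows first that
    \<open>L\<close> is bounded, then that \<open>X\<close> converges to it in norm.\<close>
  have close: "op_norm (block (X k) n - L n) \<le> e" if k: "\<And>m. m \<ge> k \<Longrightarrow> norm (X k - X m) \<le> e" for k n e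
  proof (rule op_norm_le)
    fix v :: "complex Matrix.vec" assume v: "v \<in> carrier_vec (fock_dim n)" "vec_norm2 v = 1"
    have vn: "vec_norm2 (A *\<^sub>v v)
        = sqrt (\<Sum>x<fock_dim n. (cmod (\<Sum>y<fock_dim n. A $$ (x, y) * v $ y))\<^sup>2)"
      if "A \<in> carrier_mat (fock_dim n) (fock_dim n)" for A
      using that v unfolding vec_norm2_def L2_set_def
      by (auto simp: scalar_prod_def atLeast0LessThan intro!: sum.cong)
    have "(\<lambda>m. vec_norm2 ((block (X k) n - block (X m) n) *\<^sub>v v)) \<longlonglongrightarrow> vec_norm2 ((block (X k) n - L n) *\<^sub>v v)"
      using lim carrier_matD [OF L_carrier]
      by (subst (1 2) vn)
        (auto intro!: tendsto_intros minus_carrier_mat [OF block_carrier] minus_carrier_mat [OF L_carrier])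
    moreover have "vec_norm2 ((block (X k) n - block (X m) n) *\<^sub>v v) \<le> e" if "m \<ge> k" for m
    proof -
      have "vec_norm2 (block (X k - X m) n *\<^sub>v v) \<le> op_norm (block (X k - X m) n)"
        using vec_norm2_mult_le_op_norm [OF block_carrier v(1)] v(2) by simp
      also have "\<dots> \<le> e"
        using op_norm_block_le k [OF that] by (rule order_trans)
      finally show ?thesis by (simp add: block_diff)
    qed
    ultimately show "vec_norm2 ((block (X k) n - L n) *\<^sub>v v) \<le> e"
      by (meson LIMSEQ_le_const2)
  qed (use minus_carrier_mat [OF L_carrier] in auto)
  have tail: "\<exists>k. \<forall>m\<ge>k. \<forall>m'\<ge>m. norm (X m - X m') \<le> e" if "0 < e" for e
    using X that unfolding Cauchy_def dist_norm by (meson less_imp_le order_trans)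
  obtain k where k: "\<And>m. m \<ge> k \<Longrightarrow> norm (X k - X m) \<le> 1"
    using tail [of 1] by auto
  have "op_norm (L n) \<le> norm (X k) + 1" for n
  proof -
    have "L n = block (X k) n + (- 1) \<cdot>\<^sub>m (block (X k) n - L n)"
      using L_carrier [of n] by (intro eq_matI) auto
    also have "op_norm \<dots> \<le> op_norm (block (X k) n) + op_norm ((- 1) \<cdot>\<^sub>m (block (X k) n - L n))"
      using minus_carrier_mat [OF L_carrier] by (intro op_norm_add_le) auto
    also have "\<dots> \<le> norm (X k) + 1"
      using close [OF k] op_norm_block_le
      by (subst op_norm_smult [OF minus_carrier_mat [OF L_carrier]]) (auto intro!: add_mono)
    finally show ?thesis .
  qed
  then have "L \<in> {f. (\<forall>n. f n \<in> carrier_mat (fock_dim n) (fock_dim n)) \<and> bdd_above (range (\<lambda>n. op_norm (f n)))}"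
    using L_carrier by (auto intro!: bdd_aboveI2 [where M = "norm (X k) + 1"])
  then have block_L: "block (Block L) = L" by (rule Block_inverse)
  have "X \<longlonglongrightarrow> Block L"
  proof (rule LIMSEQ_I)
    fix r :: real assume "0 < r"
    then obtain k where k: "\<And>m m'. m \<ge> k \<Longrightarrow> m' \<ge> m \<Longrightarrow> norm (X m - X m') \<le> r / 2"
      using tail [of "r / 2"] by auto
    have "norm (X m - Block L) < r" if "m \<ge> k" for m
    proof -
      have "norm (X m - Block L) \<le> r / 2"
        using close [OF k [OF that]] by (intro norm_block_op_le) (simp add: block_diff block_L)
      with \<open>0 < r\<close> show ?thesis by simp
    qed
    then show "\<exists>k. \<forall>m\<ge>k. norm (X m - Block L) < r" by blast
  qed
  then show "convergent X" by (auto simp: convergent_def)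
qed

text \<open>The series in \<open>mat_exp\<close> is a plain \<open>\<Sum>k\<close>, meaningful only
  if it converges. Convergence is inherited from the exponential series of the Banach algebra
  through the bounded linear entry maps.\<close>

lemma block_exp_sums:
  assumes "x < fock_dim n" "y < fock_dim n"
  shows "(\<lambda>k. (block f n ^\<^sub>m k) $$ (x, y) / fact k) sums (block (exp f) n $$ (x, y))"
proof -
  have "(\<lambda>k. block (f ^ k /\<^sub>R fact k) n $$ (x, y)) sums (block (exp f) n $$ (x, y))"
    by (rule bounded_linear.sums [OF block_entry_bounded_linear [OF assms] exp_converges])
  moreover have "block (f ^ k /\<^sub>R fact k) n $$ (x, y) = (block f n ^\<^sub>m k) $$ (x, y) / fact k" for k
    using assms by (simp add: block_scaleR block_power divide_inverse mult.commute)
  ultimately show ?thesis by simp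
qed

lemma block_exp: "block (exp f) n = mat_exp (block f n)"
proof (rule eq_matI)
  fix x y assume "x < dim_row (mat_exp (block f n))" "y < dim_col (mat_exp (block f n))"
  then show "block (exp f) n $$ (x, y) = mat_exp (block f n) $$ (x, y)"
    using block_exp_sums [of x n y f] by (simp add: mat_exp_def sums_iff)
qed (simp_all add: mat_exp_def)

text \<open>Zero blocks make this isometric and additive but not unital: the exponential of an
  embedded matrix is the identity in every other block.\<close>

definition embed :: "nat \<Rightarrow> complex mat \<Rightarrow> block_op"
  where "embed n A = Block (\<lambda>m. if m = n then A else 0\<^sub>m (fock_dim m) (fock_dim m))"

lemma block_embed:
  assumes "A \<in> carrier_mat (fock_dim n) (fock_dim n)"
  shows "block (embed n A) m = (if m = n then A else 0\<^sub>m (fock_dim m) (fock_dim m))"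
proof -
  have "op_norm (if m = n then A else 0\<^sub>m (fock_dim m) (fock_dim m)) \<le> op_norm A" for m
    using op_norm_nonneg [OF assms] by (simp add: op_norm_zero)
  then show ?thesis
    unfolding embed_def using assms by (subst Block_inverse) (auto intro!: bdd_aboveI2 [where M = "op_norm A"])
qed

lemma norm_embed:
  assumes "A \<in> carrier_mat (fock_dim n) (fock_dim n)"
  shows "norm (embed n A) = op_norm A"
proof (rule antisym)
  show "norm (embed n A) \<le> op_norm A"
    using assms op_norm_nonneg [OF assms] by (intro norm_block_op_le) (simp add: block_embed op_norm_zero)
  show "op_norm A \<le> norm (embed n A)"
    using op_norm_block_le [of "embed n A" n] assms by (simp add: block_embed)
qed

lemma embed_add:
  assumes "A \<in> carrier_mat (fock_dim n) (fock_dim n)" "B \<in> carrier_mat (fock_dim n) (fock_dim n)"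
  shows "embed n (A + B) = embed n A + embed n B"
  using assms by (intro block_eqI) (simp add: block_embed block_add)

lemma embed_zero: "embed n (0\<^sub>m (fock_dim n) (fock_dim n)) = 0"
  by (intro block_eqI) (simp add: block_embed block_zero)

section \<open>Convergence and inverses of matrix exponentials\<close>

lemma mat_exp_carrier [simp]: "A \<in> carrier_mat n n \<Longrightarrow> mat_exp A \<in> carrier_mat n n"
  by (simp add: mat_exp_def)

lemma mat_exp_sums:
  assumes "A \<in> carrier_mat (fock_dim n) (fock_dim n)" "x < fock_dim n" "y < fock_dim n"
  shows "(\<lambda>k. (A ^\<^sub>m k) $$ (x, y) / fact k) sums (mat_exp A $$ (x, y))"
  using block_exp_sums [OF assms(2,3), of "embed n A"] assms(1)
  by (simp add: block_exp block_embed)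

lemma mat_exp_minus_mult:
  assumes "A \<in> carrier_mat (fock_dim n) (fock_dim n)"
  shows "mat_exp (- A) * mat_exp A = 1\<^sub>m (fock_dim n)"
proof -
  have "exp (- embed n A) * exp (embed n A) = 1"
    using exp_minus_inverse [of "- embed n A"] by simp
  then have "block (exp (- embed n A)) n * block (exp (embed n A)) n = 1\<^sub>m (fock_dim n)"
    by (simp only: block_mult [symmetric] block_one)
  moreover have "block (- embed n A) n = - A"
    using assms by (simp add: uminus_block_op.rep_eq block_embed)
  ultimately show ?thesis using assms by (simp add: block_exp block_embed)
qed

lemma mat_exp_zero: "mat_exp (0\<^sub>m (fock_dim n) (fock_dim n)) = 1\<^sub>m (fock_dim n)"
  using block_exp [of 0 n] by (simp add: block_zero block_one)

section \<open>Product formulas for Hermitian matrices\<close>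

lemma mat_adjoint_dim [simp]:
  "dim_row (mat_adjoint A) = dim_col A" "dim_col (mat_adjoint A) = dim_row A"
  by (simp_all add: mat_adjoint_def)

lemma mat_adjoint_index [simp]:
  fixes A :: "complex mat"
  shows "i < dim_col A \<Longrightarrow> j < dim_row A \<Longrightarrow> mat_adjoint A $$ (i, j) = cnj (A $$ (j, i))"
  by (simp add: mat_adjoint_def mat_of_rows_index)

lemma mat_adjoint_carrier [simp]: "A \<in> carrier_mat m n \<Longrightarrow> mat_adjoint A \<in> carrier_mat n m"
  by (rule carrier_matI) simp_all

lemma mat_adjoint_mult:
  fixes A B :: "complex mat"
  assumes "A \<in> carrier_mat l m" "B \<in> carrier_mat m n"
  shows "mat_adjoint (A * B) = mat_adjoint B * mat_adjoint A"
  using assms by (intro eq_matI) (auto simp: scalar_prod_def mult.commute intro!: sum.cong)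

lemma mat_adjoint_smult: "mat_adjoint (c \<cdot>\<^sub>m A) = cnj c \<cdot>\<^sub>m mat_adjoint (A :: complex mat)"
  by (intro eq_matI) auto

lemma mat_adjoint_one [simp]: "mat_adjoint (1\<^sub>m n) = (1\<^sub>m n :: complex mat)"
  by (intro eq_matI) auto

lemma pow_mat_Suc_left:
  assumes "A \<in> carrier_mat n n"
  shows "A ^\<^sub>m Suc k = A * A ^\<^sub>m k"
proof (induction k)
  case (Suc k)
  have "A ^\<^sub>m Suc (Suc k) = A * A ^\<^sub>m k * A"
    using Suc by simp
  also have "\<dots> = A * (A ^\<^sub>m k * A)"
    using assms by (intro assoc_mult_mat) auto
  finally show ?case by simp
qed (use assms in simp)

lemma mat_adjoint_pow:
  fixes A :: "complex mat"
  assumes "A \<in> carrier_mat n n"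
  shows "mat_adjoint (A ^\<^sub>m k) = mat_adjoint A ^\<^sub>m k"
proof (induction k)
  case (Suc k)
  have "mat_adjoint (A ^\<^sub>m Suc k) = mat_adjoint A * mat_adjoint (A ^\<^sub>m k)"
    using mat_adjoint_mult [of "A ^\<^sub>m k" n n A n] assms by simp
  also have "\<dots> = mat_adjoint A ^\<^sub>m Suc k"
    using Suc pow_mat_Suc_left [of "mat_adjoint A" n k] assms by simp
  finally show ?case .
qed (use assms in simp)

lemma mat_adjoint_mat_exp:
  assumes A: "A \<in> carrier_mat (fock_dim n) (fock_dim n)"
  shows "mat_adjoint (mat_exp A) = mat_exp (mat_adjoint A)"
proof (rule eq_matI)
  fix x y assume "x < dim_row (mat_exp (mat_adjoint A))" "y < dim_col (mat_exp (mat_adjoint A))"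
  then have xy: "x < fock_dim n" "y < fock_dim n"
    using A by (simp_all add: mat_exp_def)
  have "(\<lambda>k. cnj ((A ^\<^sub>m k) $$ (y, x) / fact k)) sums cnj (mat_exp A $$ (y, x))"
    using mat_exp_sums [OF A xy(2,1)] by (simp only: sums_cnj)
  moreover have "cnj ((A ^\<^sub>m k) $$ (y, x) / fact k) = (mat_adjoint A ^\<^sub>m k) $$ (x, y) / fact k" for k
    using xy A by (simp flip: mat_adjoint_pow [OF A])
  ultimately have "mat_exp (mat_adjoint A) $$ (x, y) = cnj (mat_exp A $$ (y, x))"
    using mat_exp_sums [of "mat_adjoint A" n x y] xy A by (auto dest: sums_unique2)
  then show "mat_adjoint (mat_exp A) $$ (x, y) = mat_exp (mat_adjoint A) $$ (x, y)"
    using xy carrier_matD [OF mat_exp_carrier [OF A]] by simp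
qed (use A in \<open>simp_all add: mat_exp_def\<close>)

lemma of_real_vec_norm2_square:
  assumes "v \<in> carrier_vec n"
  shows "complex_of_real ((vec_norm2 v)\<^sup>2) = (\<Sum>x<n. v $ x * cnj (v $ x))"
  using assms by (simp add: vec_norm2_def L2_set_def sum_nonneg complex_norm_square del: of_real_power)

lemma vec_norm2_unitary:
  assumes E: "E \<in> carrier_mat n n" and unit: "mat_adjoint E * E = 1\<^sub>m n" and v: "v \<in> carrier_vec n"
  shows "vec_norm2 (E *\<^sub>v v) = vec_norm2 v"
proof -
  \<comment> \<open>Unitarity in coordinates: the columns of \<open>E\<close> are
    orthonormal.\<close>
  have col: "(\<Sum>x<n. E $$ (x, y) * cnj (E $$ (x, z))) = (if z = y then 1 else 0)"
    if "y < n" "z < n" for y z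
    using arg_cong [OF unit, of "\<lambda>M. M $$ (z, y)"] that E
    by (simp add: scalar_prod_def atLeast0LessThan mult.commute)
  have "complex_of_real ((vec_norm2 (E *\<^sub>v v))\<^sup>2)
      = (\<Sum>x<n. (\<Sum>y<n. E $$ (x, y) * v $ y) * cnj (\<Sum>z<n. E $$ (x, z) * v $ z))"
    using E v by (subst of_real_vec_norm2_square [of _ n])
      (auto simp: scalar_prod_def atLeast0LessThan intro!: sum.cong)
  also have "\<dots> = (\<Sum>x<n. \<Sum>y<n. \<Sum>z<n. v $ y * cnj (v $ z) * (E $$ (x, y) * cnj (E $$ (x, z))))"
    by (simp add: sum_product mult_ac)
  also have "\<dots> = (\<Sum>y<n. \<Sum>z<n. \<Sum>x<n. v $ y * cnj (v $ z) * (E $$ (x, y) * cnj (E $$ (x, z))))"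
    by (rule trans [OF sum.swap]) (intro sum.cong refl sum.swap)
  also have "\<dots> = (\<Sum>y<n. \<Sum>z<n. v $ y * cnj (v $ z) * (if z = y then 1 else 0))"
    by (intro sum.cong refl) (simp add: col flip: sum_distrib_left)
  also have "\<dots> = complex_of_real ((vec_norm2 v)\<^sup>2)"
    unfolding of_real_vec_norm2_square [OF v] by (simp add: if_distrib [of "(*) _"] cong: if_cong)
  finally have "(vec_norm2 (E *\<^sub>v v))\<^sup>2 = (vec_norm2 v)\<^sup>2"
    by (simp only: of_real_eq_iff)
  then show ?thesis by simp
qed

lemma op_norm_unitary_le:
  assumes "E \<in> carrier_mat n n" "mat_adjoint E * E = 1\<^sub>m n" "0 < n"
  shows "op_norm E \<le> 1"
  using assms by (intro op_norm_le [of _ n n]) (auto simp: vec_norm2_unitary)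

lemma evolution_carrier [simp]: "H \<in> carrier_mat n n \<Longrightarrow> evolution H s \<in> carrier_mat n n"
  by (simp add: evolution_def)

lemma evolution_unitary:
  assumes H: "H \<in> carrier_mat (fock_dim n) (fock_dim n)" and "mat_adjoint H = H"
  shows "mat_adjoint (evolution H s) * evolution H s = 1\<^sub>m (fock_dim n)"
proof -
  let ?A = "(- (\<i> * complex_of_real s)) \<cdot>\<^sub>m H"
  have "mat_adjoint ?A = - ?A"
    unfolding mat_adjoint_smult \<open>mat_adjoint H = H\<close> by (intro eq_matI) auto
  then show ?thesis
    using mat_adjoint_mat_exp [of ?A n] mat_exp_minus_mult [of ?A n] H
    by (simp add: evolution_def)
qed

section \<open>Transfer of the error bound from the Banach algebra to matrices\<close>

text \<open>\<open>block_op\<close> is an algebra over the reals, so the factor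
  \<open>- \<i>\<close> is put into the matrix and the time remains a real scalar.\<close>

definition generator :: "nat \<Rightarrow> complex mat \<Rightarrow> block_op"
  where "generator n H = embed n ((- \<i>) \<cdot>\<^sub>m H)"

lemma block_scaleR_generator:
  assumes "H \<in> carrier_mat (fock_dim n) (fock_dim n)"
  shows "block (s *\<^sub>R generator n H) m =
    (if m = n then (- (\<i> * complex_of_real s)) \<cdot>\<^sub>m H else 0\<^sub>m (fock_dim m) (fock_dim m))"
proof -
  have "complex_of_real s \<cdot>\<^sub>m (- \<i> \<cdot>\<^sub>m H) = (- (\<i> * complex_of_real s)) \<cdot>\<^sub>m H"
    by (intro eq_matI) auto
  then show ?thesis
    using assms by (simp add: generator_def block_scaleR block_embed)
qed

lemma block_exp_generator:
  assumes "H \<in> carrier_mat (fock_dim n) (fock_dim n)"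
  shows "block (exp (s *\<^sub>R generator n H)) m = (if m = n then evolution H s else 1\<^sub>m (fock_dim m))"
  using block_scaleR_generator [OF assms] by (simp add: block_exp evolution_def mat_exp_zero)

lemma norm_generator:
  assumes "H \<in> carrier_mat (fock_dim n) (fock_dim n)"
  shows "norm (generator n H) = op_norm H"
  using assms by (simp add: generator_def norm_embed op_norm_smult [OF assms])

text \<open>Block \<open>n\<close> is unitary and the others are identities. This is where
  self-adjointness enters the error bound.\<close>

lemma norm_exp_generator_le:
  assumes "H \<in> carrier_mat (fock_dim n) (fock_dim n)" "mat_adjoint H = H"
  shows "norm (exp (s *\<^sub>R generator n H)) \<le> 1"
  using assms op_norm_unitary_le [OF evolution_carrier [OF assms(1)] evolution_unitary [OF assms]]
  by (intro norm_block_op_le) (simp add: block_exp_generator op_norm_one)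

lemma op_prod_block: "op_prod n (map (\<lambda>x. block (f x) n) xs) = block (prod_list (map f xs)) n"
  by (induction xs) (simp_all add: op_prod_def block_one block_mult)

lemma suzuki_eq_block:
  assumes "set Hs \<subseteq> carrier_mat (fock_dim n) (fock_dim n)"
  shows "suzuki n Hs p s = block (suzuki_formula (map (generator n) Hs) p s) n"
  using assms
proof (induction n Hs p s rule: suzuki.induct)
  case (2 n Hs s)
  have "op_prod n (map (\<lambda>H. evolution H (s / 2)) Gs)
      = block (prod_list (map (\<lambda>A. exp ((s / 2) *\<^sub>R A)) (map (generator n) Gs))) n"
    if "set Gs \<subseteq> set Hs" for Gs
  proof -
    have "map (\<lambda>H. evolution H (s / 2)) Gs = map (\<lambda>H. block (exp ((s / 2) *\<^sub>R generator n H)) n) Gs"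
      using that 2 by (auto simp: block_exp_generator)
    then show ?thesis by (simp only: op_prod_block map_map o_def)
  qed
  then show ?case
    by (simp add: strang_def strang_formula_def block_mult rev_map)
next
  case (3 n Hs q s)
  then show ?case
    by (simp add: Let_def block_mult block_power)
qed (simp add: block_one)

lemma sum_list_generator:
  assumes "set Hs \<subseteq> carrier_mat (fock_dim n) (fock_dim n)"
  shows "sum_list (map (generator n) Hs)
    = generator n (foldr (+) Hs (0\<^sub>m (fock_dim n) (fock_dim n)))"
  using assms
proof (induction Hs)
  case Nil
  have "(- \<i>) \<cdot>\<^sub>m 0\<^sub>m (fock_dim n) (fock_dim n) = 0\<^sub>m (fock_dim n) (fock_dim n)"
    by (intro eq_matI) auto
  then show ?case by (simp add: generator_def embed_zero)
next
  case (Cons H Hs)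
  let ?S = "foldr (+) Hs (0\<^sub>m (fock_dim n) (fock_dim n))"
  have "?S \<in> carrier_mat (fock_dim n) (fock_dim n)"
    using Cons.prems by (induction Hs) auto
  with Cons show ?case
    by (simp add: generator_def add_smult_distrib_left_mat [of H "fock_dim n" "fock_dim n"]
        flip: embed_add)
qed

text \<open>The estimate descends from \<open>block_op\<close>: a block is bounded by the norm of
  the whole, and the generators have exactly the operator norms of the terms.\<close>

lemma suzuki_error:
  assumes Hs: "set Hs \<subseteq> carrier_mat (fock_dim n) (fock_dim n)"
    and herm: "\<And>H. H \<in> set Hs \<Longrightarrow> mat_adjoint H = H"
    and H: "H = foldr (+) Hs (0\<^sub>m (fock_dim n) (fock_dim n))" "mat_adjoint H = H"
      "H \<in> carrier_mat (fock_dim n) (fock_dim n)"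
    and "0 < p" "0 < N" "0 \<le> t"
  shows "op_norm (suzuki n Hs p (t / real N) ^\<^sub>m N - evolution H t)
    \<le> 2 * exp (suzuki_cost p) * (sum_list (map op_norm Hs) ^ (2 * p + 1) * t ^ (2 * p + 1) / real N ^ (2 * p))"
proof -
  let ?As = "map (generator n) Hs"
  have sum: "sum_list ?As = generator n H"
    using sum_list_generator [OF Hs] H(1) by simp
  have "map norm ?As = map op_norm Hs"
    using Hs by (auto simp: norm_generator)
  moreover have "op_norm (block (suzuki_formula ?As p (t / real N) ^ N - exp (t *\<^sub>R sum_list ?As)) n)
    \<le> 2 * exp (suzuki_cost p) * (sum_list (map norm ?As) ^ (2 * p + 1) * t ^ (2 * p + 1) / real N ^ (2 * p))"
    using assms by (intro order_trans [OF op_norm_block_le] suzuki_formula_error)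
      (auto simp: sum intro!: norm_exp_generator_le)
  moreover have "block (suzuki_formula ?As p (t / real N) ^ N - exp (t *\<^sub>R sum_list ?As)) n
      = suzuki n Hs p (t / real N) ^\<^sub>m N - evolution H t"
    using Hs H(3) by (simp add: block_diff block_power sum block_exp_generator suzuki_eq_block)
  ultimately show ?thesis by (simp only:)
qed

section \<open>Nonnegative combinations of characters\<close>

text \<open>Gaussian elimination: an equation with a nonzero coefficient is solved for one unknown,
  which is substituted into the other equations.\<close>

lemma nontrivial_homogeneous_solution:
  fixes g :: "'e \<Rightarrow> 'b \<Rightarrow> 'k::field"
  assumes "finite E" "finite B" "card E < card B"
  shows "\<exists>c. (\<exists>b\<in>B. c b \<noteq> 0) \<and> (\<forall>e\<in>E. (\<Sum>b\<in>B. c b * g e b) = 0)"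
  using assms
proof (induction E arbitrary: B g rule: finite_induct)
  case empty
  then obtain b where "b \<in> B" by fastforce
  then show ?case by (intro exI [of _ "\<lambda>_. 1"]) auto
next
  case (insert e E)
  show ?case
  proof (cases "\<forall>b\<in>B. g e b = 0")
    case True
    obtain c where "\<exists>b\<in>B. c b \<noteq> 0" "\<forall>e\<in>E. (\<Sum>b\<in>B. c b * g e b) = 0"
      using insert.IH [of B g] insert.prems insert.hyps by auto
    with True show ?thesis by (intro exI [of _ c]) (auto intro: sum.neutral)
  next
    case False
    then obtain b0 where b0: "b0 \<in> B" "g e b0 \<noteq> 0" by blast
    define B' where "B' = B - {b0}"
    have B': "finite B'" "card E < card B'"
      using insert.prems insert.hyps b0 by (simp_all add: B'_def)
    obtain c where c: "\<exists>b\<in>B'. c b \<noteq> 0"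
      "\<And>e'. e' \<in> E \<Longrightarrow> (\<Sum>b\<in>B'. c b * (g e' b - g e b / g e b0 * g e' b0)) = 0"
      using insert.IH [OF B', of "\<lambda>e' b. g e' b - g e b / g e b0 * g e' b0"] by blast
    define s where "s = (\<Sum>b\<in>B'. c b * g e b)"
    \<comment> \<open>The value at \<open>b0\<close> is the one that equation \<open>e\<close>
      forces.\<close>
    define c' where "c' = c(b0 := - s / g e b0)"
    have c'B': "c' b = c b" if "b \<in> B'" for b
      using that by (auto simp: c'_def B'_def)
    have split: "(\<Sum>b\<in>B. c' b * g e' b) = - s / g e b0 * g e' b0 + (\<Sum>b\<in>B'. c b * g e' b)" for e'
    proof -
      have "(\<Sum>b\<in>B. c' b * g e' b) = c' b0 * g e' b0 + (\<Sum>b\<in>B'. c' b * g e' b)"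
        using insert.prems b0 by (simp add: B'_def sum.remove)
      also have "(\<Sum>b\<in>B'. c' b * g e' b) = (\<Sum>b\<in>B'. c b * g e' b)"
        by (simp add: c'B' cong: sum.cong)
      finally show ?thesis by (simp add: c'_def)
    qed
    have "(\<Sum>b\<in>B. c' b * g e' b) = 0" if "e' \<in> E" for e'
    proof -
      have "(\<Sum>b\<in>B'. c b * (g e' b - g e b / g e b0 * g e' b0))
          = (\<Sum>b\<in>B'. c b * g e' b) - (\<Sum>b\<in>B'. c b * g e b * (g e' b0 / g e b0))"
        by (simp add: algebra_simps sum_subtractf)
      also have "(\<Sum>b\<in>B'. c b * g e b * (g e' b0 / g e b0)) = s * (g e' b0 / g e b0)"
        unfolding s_def by (simp only: sum_distrib_right)
      finally show ?thesis using c(2) [OF that] by (simp add: split)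
    qed
    moreover have "(\<Sum>b\<in>B. c' b * g e b) = 0"
      using b0 unfolding split by (simp flip: s_def)
    moreover have "\<exists>b\<in>B. c' b \<noteq> 0"
      using c(1) c'B' unfolding B'_def by (metis DiffD1)
    ultimately show ?thesis by blast
  qed
qed

text \<open>Caratheodory's theorem for cones, in coordinates: moving along a linear dependency among the
  columns that carry weight removes one of them.\<close>

lemma sparse_nonneg_solution:
  fixes g :: "'e \<Rightarrow> 'b \<Rightarrow> real"
  assumes E: "finite E" and B: "finite B" and "\<And>b. b \<in> B \<Longrightarrow> 0 \<le> w b"
  shows "\<exists>w'. (\<forall>b\<in>B. 0 \<le> w' b) \<and> card {b\<in>B. w' b \<noteq> 0} \<le> card E \<and>
    (\<forall>e\<in>E. (\<Sum>b\<in>B. w' b * g e b) = (\<Sum>b\<in>B. w b * g e b))"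
  using assms(3)
proof (induction "card {b\<in>B. w b \<noteq> 0}" arbitrary: w rule: less_induct)
  case less
  let ?S = "{b\<in>B. w b \<noteq> 0}"
  show ?case
  proof (cases "card ?S \<le> card E")
    case True
    with less.prems show ?thesis by blast
  next
    case False
    with B obtain c0 where c0: "\<exists>b\<in>?S. c0 b \<noteq> 0" "\<And>e. e \<in> E \<Longrightarrow> (\<Sum>b\<in>?S. c0 b * g e b) = 0"
      using nontrivial_homogeneous_solution [OF E, of ?S g] by auto
    \<comment> \<open>The sign of a dependency is free, so one with a positive entry can be
      chosen.\<close>
    obtain c where c: "\<exists>b\<in>?S. 0 < c b" "\<And>e. e \<in> E \<Longrightarrow> (\<Sum>b\<in>?S. c b * g e b) = 0"
    proof (cases "\<exists>b\<in>?S. 0 < c0 b")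
      case True
      with c0 that show ?thesis by blast
    next
      case False
      with c0(1) have "\<exists>b\<in>?S. 0 < - c0 b" by force
      moreover have "\<And>e. e \<in> E \<Longrightarrow> (\<Sum>b\<in>?S. - c0 b * g e b) = 0"
        using c0(2) by (simp add: sum_negf)
      ultimately show ?thesis using that [of "\<lambda>b. - c0 b"] by blast
    qed
    let ?P = "{b\<in>?S. 0 < c b}"
    have "finite ?P" "?P \<noteq> {}" using B c(1) by auto
    \<comment> \<open>The smallest ratio is the longest move along \<open>c\<close> that keeps all
      weights nonnegative; it brings the weight at \<open>b1\<close> to 0.\<close>
    then obtain b1 where b1: "b1 \<in> ?P" "\<And>b. b \<in> ?P \<Longrightarrow> w b1 / c b1 \<le> w b / c b"
      using obtains_MIN [of ?P "\<lambda>b. w b / c b"] by (metis (no_types, lifting) Min_le finite_imageI imageI)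
    define t where "t = w b1 / c b1"
    define v where "v b = (if b \<in> ?S then w b - t * c b else 0)" for b
    have "0 \<le> t" using b1(1) less.prems by (auto simp: t_def)
    have v_nonneg: "0 \<le> v b" if "b \<in> B" for b
    proof (cases "b \<in> ?P")
      case True
      then show ?thesis using b1(2) [of b] by (auto simp: v_def t_def field_simps)
    next
      case False
      then have "b \<in> ?S \<Longrightarrow> t * c b \<le> 0"
        using \<open>0 \<le> t\<close> by (auto simp: mult_le_0_iff)
      then show ?thesis using less.prems [OF that] by (auto simp: v_def)
    qed
    have "{b\<in>B. v b \<noteq> 0} \<subseteq> ?S - {b1}"
      using b1(1) by (auto simp: v_def t_def split: if_splits)
    moreover have "?S - {b1} \<subset> ?S" using b1(1) by auto
    ultimately have "card {b\<in>B. v b \<noteq> 0} < card ?S"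
      using B by (intro psubset_card_mono) auto
    from less.hyps [OF this v_nonneg] obtain w' where w': "\<forall>b\<in>B. 0 \<le> w' b"
      "card {b\<in>B. w' b \<noteq> 0} \<le> card E" "\<forall>e\<in>E. (\<Sum>b\<in>B. w' b * g e b) = (\<Sum>b\<in>B. v b * g e b)"
      by blast
    have "(\<Sum>b\<in>B. v b * g e b) = (\<Sum>b\<in>B. w b * g e b)" if "e \<in> E" for e
    proof -
      have "(\<Sum>b\<in>B. v b * g e b) = (\<Sum>b\<in>?S. (w b - t * c b) * g e b)"
        using B by (intro sum.mono_neutral_cong_right) (auto simp: v_def)
      also have "\<dots> = (\<Sum>b\<in>?S. w b * g e b) - t * (\<Sum>b\<in>?S. c b * g e b)"
        by (simp add: algebra_simps sum_subtractf sum_distrib_left)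
      also have "\<dots> = (\<Sum>b\<in>?S. w b * g e b)" using c(2) [OF that] by simp
      also have "\<dots> = (\<Sum>b\<in>B. w b * g e b)"
        using B by (intro sum.mono_neutral_left) auto
      finally show ?thesis .
    qed
    with w' show ?thesis by auto
  qed
qed

section \<open>Characters of ternary strings with addition modulo 3\<close>

definition cubic_phase :: "int \<Rightarrow> complex"
  where "cubic_phase k = cis (2 * pi * real_of_int k / 3)"

lemma cubic_phase_0 [simp]: "cubic_phase 0 = 1"
  by (simp add: cubic_phase_def)

lemma cubic_phase_add: "cubic_phase (k + l) = cubic_phase k * cubic_phase l"
  by (simp add: cubic_phase_def cis_mult add_divide_distrib distrib_left)

lemma cnj_cubic_phase: "cnj (cubic_phase k) = cubic_phase (- k)"
  by (simp add: cubic_phase_def cis_cnj)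

lemma cubic_phase_sum: "cubic_phase (sum f A) = (\<Prod>j\<in>A. cubic_phase (f j))"
  by (induction A rule: infinite_finite_induct) (simp_all add: cubic_phase_add)

text \<open>\<open>c\<close> is not divisible by 3, so all three cube roots of unity occur once. The
  listed values are the nonzero sums and differences of two entries.\<close>

lemma cubic_phase_sum_eq_0:
  assumes "c \<in> {- 2, - 1, 1, 2}"
  shows "(\<Sum>z\<in>{- 1, 0, 1}. cubic_phase (c * z)) = 0"
proof -
  have c120: "cos (2 * pi / 3) = - 1 / 2" by (rule cos_120)
  have "cos (4 * pi / 3) = cos (2 * pi - 2 * pi / 3)" by (rule arg_cong [of _ _ cos]) simp
  also have "\<dots> = cos (2 * pi / 3)" by (rule cos_2pi_minus)
  finally have c240: "cos (4 * pi / 3) = - 1 / 2" by (simp only: c120)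
  show ?thesis
    using assms c120 c240 by (auto simp: cubic_phase_def complex_eq_iff)
qed

definition dot :: "nat \<Rightarrow> (nat \<Rightarrow> int) \<Rightarrow> (nat \<Rightarrow> int) \<Rightarrow> int"
  where "dot n a b = (\<Sum>j\<in>{1..n}. a j * b j)"

lemma finite_strings [simp]: "finite (strings n)"
  by (simp add: strings_def finite_PiE)

lemma sum_cubic_phase_dot:
  "(\<Sum>b\<in>strings n. cubic_phase (dot n c b)) = (\<Prod>j\<in>{1..n}. \<Sum>z\<in>{- 1, 0, 1}. cubic_phase (c j * z))"
  unfolding strings_def dot_def cubic_phase_sum by (subst prod_sum_PiE) auto

text \<open>The character sum factors over the coordinates, and coordinate \<open>j\<close>
  contributes a factor 0.\<close>

lemma sum_cubic_phase_dot_eq_0: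
  assumes "j \<in> {1..n}" "c j \<in> {- 2, - 1, 1, 2}"
  shows "(\<Sum>b\<in>strings n. cubic_phase (dot n c b)) = 0"
  unfolding sum_cubic_phase_dot using cubic_phase_sum_eq_0 [OF assms(2)] assms(1)
  by (intro prod_zero) auto

lemma strings_entry: "a \<in> strings n \<Longrightarrow> j \<in> {1..n} \<Longrightarrow> a j \<in> {- 1, 0, 1}"
  by (auto simp: strings_def PiE_def Pi_def)

lemma pos_strings_subset: "pos_strings n \<subseteq> strings n"
  by (auto simp: pos_strings_def)

lemma pos_stringsE:
  assumes "a \<in> pos_strings n"
  obtains j where "j \<in> {1..n}" "a j = 1" "\<And>i. i \<in> {1..<j} \<Longrightarrow> a i = 0"
  using assms by (auto simp: pos_strings_def)

text \<open>At the earlier of the two leading positions the sum is 1, or 2 if the positions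
  coincide. So the character of a positive string is never the conjugate of that of another, nor of
  its own.\<close>

lemma pos_strings_add_entry:
  assumes "a \<in> pos_strings n" "a' \<in> pos_strings n"
  obtains j where "j \<in> {1..n}" "a j + a' j \<in> {- 2, - 1, 1, 2}"
proof -
  obtain j where j: "j \<in> {1..n}" "a j = 1" "\<And>i. i \<in> {1..<j} \<Longrightarrow> a i = 0"
    using assms(1) by (rule pos_stringsE) blast
  obtain k where k: "k \<in> {1..n}" "a' k = 1" "\<And>i. i \<in> {1..<k} \<Longrightarrow> a' i = 0"
    using assms(2) by (rule pos_stringsE) blast
  consider "j < k" | "k < j" | "j = k" by linarith
  then show ?thesis
  proof cases
    case 1 then show ?thesis using that [of j] j k by simp
  next
    case 2 then show ?thesis using that [of k] j k by simp
  next
    case 3 then show ?thesis using that [of k] j k by simp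
  qed
qed

lemma strings_diff_entry:
  assumes "a \<in> strings n" "a' \<in> strings n" "a \<noteq> a'"
  obtains j where "j \<in> {1..n}" "a j - a' j \<in> {- 2, - 1, 1, 2}"
proof -
  obtain j where "j \<in> {1..n}" "a j \<noteq> a' j"
    using assms unfolding strings_def by (metis PiE_ext)
  with strings_entry [OF assms(1)] strings_entry [OF assms(2)] show ?thesis
    using that [of j] by fastforce
qed

text \<open>Except for \<open>a = a'\<close> in the first sum, some coordinate is nonzero modulo 3.
  In the inversion below, the three sums isolate one coefficient, annihilate the conjugate half of a
  real part, and make constant weights harmless.\<close>

lemma pos_strings_orthogonal:
  assumes "a \<in> pos_strings n" "a' \<in> pos_strings n"
  shows "(\<Sum>b\<in>strings n. cubic_phase (dot n a b - dot n a' b)) = (if a = a' then of_nat (card (strings n)) else 0)"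
    and "(\<Sum>b\<in>strings n. cubic_phase (dot n a b + dot n a' b)) = 0"
    and "(\<Sum>b\<in>strings n. cubic_phase (dot n a b)) = 0"
proof -
  have diff: "dot n a b - dot n a' b = dot n (\<lambda>j. a j - a' j) b"
    and add: "dot n a b + dot n a' b = dot n (\<lambda>j. a j + a' j) b" for b
    by (simp_all add: dot_def left_diff_distrib sum_subtractf distrib_right sum.distrib)
  show "(\<Sum>b\<in>strings n. cubic_phase (dot n a b - dot n a' b)) = (if a = a' then of_nat (card (strings n)) else 0)"
  proof (cases "a = a'")
    case False
    obtain j where "j \<in> {1..n}" "a j - a' j \<in> {- 2, - 1, 1, 2}"
      using strings_diff_entry assms pos_strings_subset False by blast
    then show ?thesis
      using sum_cubic_phase_dot_eq_0 [of j n "\<lambda>j. a j - a' j"] False by (simp add: diff)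
  qed simp
  obtain j where "j \<in> {1..n}" "a j + a' j \<in> {- 2, - 1, 1, 2}"
    using pos_strings_add_entry [OF assms] by blast
  then show "(\<Sum>b\<in>strings n. cubic_phase (dot n a b + dot n a' b)) = 0"
    using sum_cubic_phase_dot_eq_0 [of j n "\<lambda>j. a j + a' j"] by (simp add: add)
  obtain j where "j \<in> {1..n}" "a j = 1" using assms(1) by (rule pos_stringsE)
  then show "(\<Sum>b\<in>strings n. cubic_phase (dot n a b)) = 0"
    using sum_cubic_phase_dot_eq_0 [of j n a] by simp
qed

text \<open>Positive strings and their negatives are disjoint. The bound ensures that there are
  enough strings for \<open>2 * r\<close> distinct pulses.\<close>

lemma card_pos_strings_le:
  "2 * card (pos_strings n) \<le> card (strings n)"
proof -
  \<comment> \<open>Restriction to \<open>{1..n}\<close> keeps the negative extensional, as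
    membership in \<open>strings n\<close> requires.\<close>
  define neg :: "(nat \<Rightarrow> int) \<Rightarrow> nat \<Rightarrow> int" where "neg a = (\<lambda>j\<in>{1..n}. - a j)" for a
  have ne: "neg a j = - a j" if "j \<in> {1..n}" for a j using that by (simp add: neg_def)
  have "inj_on neg (pos_strings n)"
  proof (rule inj_onI)
    fix a b assume ab: "a \<in> pos_strings n" "b \<in> pos_strings n" "neg a = neg b"
    then have "a j = b j" if "j \<in> {1..n}" for j
      using that ne by (metis neg_equal_iff_equal)
    then show "a = b"
      using ab pos_strings_subset unfolding strings_def by (meson PiE_ext subsetD)
  qed
  then have "card (neg ` pos_strings n) = card (pos_strings n)" by (rule card_image)
  moreover have sub: "neg ` pos_strings n \<subseteq> strings n"
  proof
    fix a assume "a \<in> neg ` pos_strings n"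
    then obtain b where "b \<in> strings n" "a = neg b" using pos_strings_subset by blast
    moreover from this have "neg b j \<in> {- 1, 0, 1}" if "j \<in> {1..n}" for j
      using strings_entry [of b n j] that ne [OF that] by auto
    ultimately show "a \<in> strings n"
      unfolding strings_def by (intro PiE_I) (auto simp: neg_def)
  qed
  moreover have "pos_strings n \<inter> neg ` pos_strings n = {}"
  proof (rule equals0I)
    fix a assume "a \<in> pos_strings n \<inter> neg ` pos_strings n"
    then obtain b where "a \<in> pos_strings n" "b \<in> pos_strings n" "a = neg b" by blast
    moreover from this obtain j where "j \<in> {1..n}" "a j + b j \<in> {- 2, - 1, 1, 2}"
      using pos_strings_add_entry by blast
    ultimately show False using ne by simp
  qed
  ultimately have "2 * card (pos_strings n) = card (pos_strings n \<union> neg ` pos_strings n)"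
    using pos_strings_subset finite_subset [OF _ finite_strings] by (subst card_Un_disjoint) auto
  also have "\<dots> \<le> card (strings n)"
    using sub pos_strings_subset by (intro card_mono) auto
  finally show ?thesis .
qed

lemma nonneg_weights_exist:
  assumes A: "A \<subseteq> pos_strings n"
  shows "\<exists>w. (\<forall>b\<in>strings n. 0 \<le> w b) \<and>
    (\<forall>a\<in>A. (\<Sum>b\<in>strings n. complex_of_real (w b) * cubic_phase (dot n a b)) = x a)"
proof -
  define N where "N = real (card (strings n))"
  have "(\<lambda>j\<in>{1..n}. 0) \<in> strings n" by (auto simp: strings_def)
  then have "N > 0" by (auto simp: N_def card_gt_0_iff)
  define z where "z b = (\<Sum>a\<in>A. x a * cubic_phase (- dot n a b))" for b
  \<comment> \<open>By Fourier inversion, \<open>z b / N\<close> would solve the equations with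
    complex weights. The conjugate half of the real part is orthogonal to every character involved,
    so the factor 2 makes up for the lost half.\<close>
  define u where "u b = 2 / N * Re (z b)" for b
  \<comment> \<open>A constant that dominates every \<open>\<bar>u b\<bar>\<close>; adding it makes
    the weights nonnegative and leaves the equations intact.\<close>
  define M where "M = (\<Sum>b\<in>strings n. \<bar>u b\<bar>)"
  have fin: "finite A" using A pos_strings_subset finite_strings finite_subset by metis
  have "\<bar>u b\<bar> \<le> M" if "b \<in> strings n" for b
    unfolding M_def using that by (intro member_le_sum) auto
  then have "0 \<le> u b + M" if "b \<in> strings n" for b
    using that by force
  moreover have "(\<Sum>b\<in>strings n. complex_of_real (u b + M) * cubic_phase (dot n a b)) = x a"
    if a: "a \<in> A" for a
  proof -
    have aP: "a \<in> pos_strings n" using a A by blast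
    have N: "of_nat (card (strings n)) = complex_of_real N" by (simp add: N_def)
    have u: "complex_of_real (u b) * y = (z b * y + cnj (z b) * y) / complex_of_real N" for b y
      by (simp add: u_def complex_add_cnj flip: distrib_right)
    have "z b * cubic_phase (dot n a b) = (\<Sum>a'\<in>A. x a' * cubic_phase (dot n a b - dot n a' b))"
      and "cnj (z b) * cubic_phase (dot n a b) = (\<Sum>a'\<in>A. cnj (x a') * cubic_phase (dot n a b + dot n a' b))" for b
      unfolding z_def cnj_sum sum_distrib_right
      by (intro sum.cong refl; simp add: cnj_cubic_phase mult.assoc add.commute flip: cubic_phase_add)+
    note z_mult = this
    have "(\<Sum>b\<in>strings n. z b * cubic_phase (dot n a b))
        = (\<Sum>b\<in>strings n. \<Sum>a'\<in>A. x a' * cubic_phase (dot n a b - dot n a' b))"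
      by (simp only: z_mult)
    also have "\<dots> = (\<Sum>a'\<in>A. x a' * (\<Sum>b\<in>strings n. cubic_phase (dot n a b - dot n a' b)))"
      by (subst sum.swap) (simp add: sum_distrib_left)
    also have "\<dots> = (\<Sum>a'\<in>A. if a = a' then x a' * complex_of_real N else 0)"
      using A by (intro sum.cong refl) (auto simp: pos_strings_orthogonal(1) [OF aP] N)
    also have "\<dots> = x a * complex_of_real N" using fin a by simp
    finally have 1: "(\<Sum>b\<in>strings n. z b * cubic_phase (dot n a b)) = x a * complex_of_real N" .
    have "(\<Sum>b\<in>strings n. cnj (z b) * cubic_phase (dot n a b))
        = (\<Sum>b\<in>strings n. \<Sum>a'\<in>A. cnj (x a') * cubic_phase (dot n a b + dot n a' b))"
      by (simp only: z_mult)
    also have "\<dots> = (\<Sum>a'\<in>A. cnj (x a') * (\<Sum>b\<in>strings n. cubic_phase (dot n a b + dot n a' b)))"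
      by (subst sum.swap) (simp add: sum_distrib_left)
    also have "\<dots> = 0"
      using A pos_strings_orthogonal(2) [OF aP] by (intro sum.neutral) auto
    finally have 2: "(\<Sum>b\<in>strings n. cnj (z b) * cubic_phase (dot n a b)) = 0" .
    have "(\<Sum>b\<in>strings n. complex_of_real (u b + M) * cubic_phase (dot n a b))
        = (\<Sum>b\<in>strings n. complex_of_real (u b) * cubic_phase (dot n a b))
          + complex_of_real M * (\<Sum>b\<in>strings n. cubic_phase (dot n a b))"
      by (simp add: distrib_right sum.distrib sum_distrib_left)
    also have "(\<Sum>b\<in>strings n. complex_of_real (u b) * cubic_phase (dot n a b)) = x a"
      using \<open>N > 0\<close> by (simp add: u sum.distrib 1 2 flip: sum_divide_distrib)
    finally show ?thesis using pos_strings_orthogonal(3) [OF aP aP] by simp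
  qed
  ultimately show ?thesis by (intro exI [of _ "\<lambda>b. u b + M"]) auto
qed

text \<open>Real and imaginary parts make \<open>2 * card A\<close> real equations, so at most that
  many weights need to be nonzero; zero weights pad the list to exactly this length.\<close>

lemma sparse_nonneg_weights_exist:
  assumes A: "A \<subseteq> pos_strings n"
  obtains bs w where "length bs = 2 * card A" "distinct bs" "set bs \<subseteq> strings n"
    "\<And>b. b \<in> set bs \<Longrightarrow> 0 \<le> (w b :: real)"
    "\<And>a. a \<in> A \<Longrightarrow> (\<Sum>b\<in>set bs. complex_of_real (w b) * cubic_phase (dot n a b)) = x a"
proof -
  have fin: "finite A" using A pos_strings_subset finite_strings finite_subset by metis
  obtain w0 where w0: "\<And>b. b \<in> strings n \<Longrightarrow> 0 \<le> (w0 b :: real)"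
    "\<And>a. a \<in> A \<Longrightarrow> (\<Sum>b\<in>strings n. complex_of_real (w0 b) * cubic_phase (dot n a b)) = x a"
    using nonneg_weights_exist [OF A, of x] by blast
  \<comment> \<open>The Boolean selects the real or the imaginary part of the equation for
    \<open>a\<close>.\<close>
  define g where "g = (\<lambda>(a, re) b. if re then Re (cubic_phase (dot n a b)) else Im (cubic_phase (dot n a b)))"
  obtain w where w: "\<forall>b\<in>strings n. 0 \<le> w b"
    "card {b\<in>strings n. w b \<noteq> 0} \<le> card (A \<times> (UNIV :: bool set))"
    "\<And>e. e \<in> A \<times> UNIV \<Longrightarrow> (\<Sum>b\<in>strings n. w b * g e b) = (\<Sum>b\<in>strings n. w0 b * g e b)"
    using sparse_nonneg_solution [of "A \<times> UNIV" "strings n" w0 g] fin w0(1) by auto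
  have "card A \<le> card (pos_strings n)"
    using A pos_strings_subset finite_strings finite_subset card_mono by metis
  then have "2 * card A \<le> card (strings n)" using card_pos_strings_le [of n] by linarith
  moreover have "card {b\<in>strings n. w b \<noteq> 0} \<le> 2 * card A"
    using w(2) by (simp add: card_cartesian_product)
  ultimately obtain S where S: "{b\<in>strings n. w b \<noteq> 0} \<subseteq> S" "S \<subseteq> strings n" "card S = 2 * card A"
    using exists_subset_between [of "{b\<in>strings n. w b \<noteq> 0}" "2 * card A" "strings n"] by auto
  have "finite S" using S(2) finite_strings finite_subset by metis
  then obtain bs where bs: "set bs = S" "distinct bs" using finite_distinct_list by blast
  show thesis
  proof (rule that [of bs w])
    show "length bs = 2 * card A" using bs S(3) distinct_card by fastforce
    fix a assume a: "a \<in> A"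
    have "(\<Sum>b\<in>set bs. complex_of_real (w b) * cubic_phase (dot n a b))
        = (\<Sum>b\<in>strings n. complex_of_real (w b) * cubic_phase (dot n a b))"
      using S bs by (intro sum.mono_neutral_left) auto
    also have "\<dots> = (\<Sum>b\<in>strings n. complex_of_real (w0 b) * cubic_phase (dot n a b))"
      using w(3) [of "(a, True)"] w(3) [of "(a, False)"] a by (simp add: g_def complex_eq_iff)
    also have "\<dots> = x a" by (rule w0(2) [OF a])
    finally show "(\<Sum>b\<in>set bs. complex_of_real (w b) * cubic_phase (dot n a b)) = x a" .
  qed (use bs S w in auto)
qed

section \<open>Pulses on the Fock space\<close>

lemma mat_diag_index: "x < N \<Longrightarrow> y < N \<Longrightarrow> mat_diag N d $$ (x, y) = (if x = y then d x else 0)"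
  by (simp add: mat_diag_def)

lemma mat_diag_pow: "mat_diag N d ^\<^sub>m k = mat_diag N (\<lambda>x. d x ^ k :: 'a::comm_semiring_1)"
proof (induction k)
  case 0
  show ?case by (simp add: mat_diag_def)
next
  case (Suc k)
  then show ?case by (simp add: mult.commute)
qed

lemma mat_diag_conj_index:
  fixes d e :: "nat \<Rightarrow> 'a::comm_semiring_1"
  assumes "M \<in> carrier_mat N N" "x < N" "y < N"
  shows "(mat_diag N d * M * mat_diag N e) $$ (x, y) = d x * M $$ (x, y) * e y"
  using assms by (simp add: mat_diag_mult_left [OF assms(1)] mat_diag_mult_right [of _ N N])

lemma mat_adjoint_mat_diag: "mat_adjoint (mat_diag N d) = mat_diag N (\<lambda>x. cnj (d x))"
  by (intro eq_matI) (auto simp: mat_diag_def)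

lemma mat_exp_mat_diag: "mat_exp (mat_diag N d) = mat_diag N (\<lambda>x. exp (d x))"
proof (rule eq_matI)
  fix x y assume "x < dim_row (mat_diag N (\<lambda>x. exp (d x)))" "y < dim_col (mat_diag N (\<lambda>x. exp (d x)))"
  then have xy: "x < N" "y < N" by (simp_all add: mat_diag_def)
  have "(\<Sum>k. d x ^ k / fact k) = exp (d x)"
    using exp_converges [of "d x"] by (simp add: sums_iff scaleR_conv_of_real divide_inverse mult.commute)
  then show "mat_exp (mat_diag N d) $$ (x, y) = mat_diag N (\<lambda>x. exp (d x)) $$ (x, y)"
    using xy by (simp add: mat_exp_def mat_diag_pow mat_diag_index) (auto simp: mat_diag_def)
qed (simp_all add: mat_exp_def mat_diag_def)

text \<open>The two diagonal matrices are inverse to each other, so the conjugation passes through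
  every power and hence through the series.\<close>

lemma mat_exp_conj:
  fixes M :: "complex mat"
  assumes M: "M \<in> carrier_mat (fock_dim n) (fock_dim n)" and de: "\<And>x. d x * e x = 1"
  shows "mat_exp (mat_diag (fock_dim n) d * M * mat_diag (fock_dim n) e)
    = mat_diag (fock_dim n) d * mat_exp M * mat_diag (fock_dim n) e"
    (is "mat_exp (?D * M * ?E) = _")
proof (rule eq_matI)
  have M': "?D * M * ?E \<in> carrier_mat (fock_dim n) (fock_dim n)"
    using M by (intro mult_carrier_mat [of _ _ "fock_dim n"]) auto
  have "similar_mat_wit (?D * M * ?E) M ?D ?E"
    using M M' de by (intro similar_mat_witI [of _ _ "fock_dim n"]) (auto simp: mult.commute)
  then have pow: "(?D * M * ?E) ^\<^sub>m k = ?D * M ^\<^sub>m k * ?E" for k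
    by (rule similar_mat_wit_pow_id)
  fix x y assume "x < dim_row (?D * mat_exp M * ?E)" "y < dim_col (?D * mat_exp M * ?E)"
  then have xy: "x < fock_dim n" "y < fock_dim n" by (simp_all add: mat_diag_def)
  have "(\<lambda>k. (d x * e y) * ((M ^\<^sub>m k) $$ (x, y) / fact k)) sums ((d x * e y) * mat_exp M $$ (x, y))"
    by (rule sums_mult [OF mat_exp_sums [OF M xy]])
  moreover have "(\<lambda>k. ((?D * M * ?E) ^\<^sub>m k) $$ (x, y) / fact k) sums (mat_exp (?D * M * ?E) $$ (x, y))"
    by (rule mat_exp_sums [OF M' xy])
  ultimately show "mat_exp (?D * M * ?E) $$ (x, y) = (?D * mat_exp M * ?E) $$ (x, y)"
    using xy M by (auto simp: pow mat_diag_conj_index mult_ac dest: sums_unique2)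
qed (simp_all add: mat_exp_def mat_diag_def)

section \<open>Occupation numbers and the diagonal form of the pulses\<close>

definition occupation :: "nat \<Rightarrow> nat \<Rightarrow> int"
  where "occupation x j = (if j \<in> occ x then 1 else 0)"

lemma occ_inject: "occ x = occ y \<longleftrightarrow> x = y"
  unfolding occ_def by (metis inj_Suc inj_image_eq_iff set_decode_inverse)

text \<open>Emptying a mode clears a binary digit, which cannot increase the index.\<close>

lemma occ_diff_exists:
  assumes "x < fock_dim n"
  obtains z where "z < fock_dim n" "occ z = occ x - {j}"
proof -
  define z where "z = set_encode {i \<in> set_decode x. Suc i \<noteq> j}"
  have z: "set_decode z = {i \<in> set_decode x. Suc i \<noteq> j}"
    by (simp add: z_def)
  then have "z \<le> x" by (intro subset_decode_imp_le) auto
  moreover have "occ z = occ x - {j}" by (auto simp: occ_def z)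
  ultimately show thesis using that [of z] assms by simp
qed

lemma creation_carrier [simp]: "creation n j \<in> carrier_mat (fock_dim n) (fock_dim n)"
  by (simp add: creation_def)

text \<open>Creation at \<open>j\<close> leads to \<open>x\<close> only from the state with mode
  \<open>j\<close> emptied, so the sum over intermediate states has at most one nonzero term, and
  there the sign is squared.\<close>

lemma number_op_eq: "number_op n j = mat_diag (fock_dim n) (\<lambda>x. of_int (occupation x j))"
proof (rule eq_matI)
  fix x y assume "x < dim_row (mat_diag (fock_dim n) (\<lambda>x. complex_of_int (occupation x j)))"
    "y < dim_col (mat_diag (fock_dim n) (\<lambda>x. complex_of_int (occupation x j)))"
  then have xy: "x < fock_dim n" "y < fock_dim n" by (simp_all add: mat_diag_def)
  obtain z where z: "z < fock_dim n" "occ z = occ x - {j}"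
    using occ_diff_exists [OF xy(1)] by blast
  have "number_op n j $$ (x, y) = (\<Sum>w<fock_dim n. creation n j $$ (x, w) * cnj (creation n j $$ (y, w)))"
    using xy carrier_matD [OF creation_carrier]
    by (auto simp: number_op_def annihilation_def scalar_prod_def atLeast0LessThan intro!: sum.cong)
  also have "\<dots> = (\<Sum>w<fock_dim n. if w = z \<and> x = y \<and> j \<in> occ x then 1 else 0)"
  proof (intro sum.cong refl)
    fix w assume w: "w \<in> {..<fock_dim n}"
    have "w = z \<longleftrightarrow> occ w = occ x - {j}" by (simp add: z(2) flip: occ_inject)
    then have iff: "j \<notin> occ w \<and> occ x = insert j (occ w) \<and> occ y = insert j (occ w)
        \<longleftrightarrow> w = z \<and> x = y \<and> j \<in> occ x"
      by (auto simp flip: occ_inject)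
    define s :: complex where "s = (- 1) ^ card {l \<in> occ w. l < j}"
    have "s * cnj s = 1" by (simp add: s_def flip: power_mult_distrib)
    have c: "creation n j $$ (u, w) = (if j \<notin> occ w \<and> occ u = insert j (occ w) then s else 0)"
      if "u < fock_dim n" for u
      using that w by (simp add: creation_def s_def)
    have "creation n j $$ (x, w) * cnj (creation n j $$ (y, w))
        = (if j \<notin> occ w \<and> occ x = insert j (occ w) \<and> occ y = insert j (occ w) then s * cnj s else 0)"
      unfolding c [OF xy(1)] c [OF xy(2)] by simp
    then show "creation n j $$ (x, w) * cnj (creation n j $$ (y, w))
        = (if w = z \<and> x = y \<and> j \<in> occ x then 1 else 0)"
      unfolding iff \<open>s * cnj s = 1\<close> .
  qed
  also have "\<dots> = (if x = y then of_int (occupation x j) else 0)"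
    using z(1) by (simp add: occupation_def if_conn cong: if_cong)
  finally show "number_op n j $$ (x, y) = mat_diag (fock_dim n) (\<lambda>x. of_int (occupation x j)) $$ (x, y)"
    using xy by (simp add: mat_diag_index)
qed (simp_all add: number_op_def mat_diag_def creation_def annihilation_def)

lemma pulse_mode_eq: "pulse_mode n j = mat_diag (fock_dim n) (\<lambda>x. cubic_phase (- occupation x j))"
proof -
  have "(- (2 * complex_of_real pi * \<i> / 3)) \<cdot>\<^sub>m number_op n j
      = mat_diag (fock_dim n) (\<lambda>x. \<i> * complex_of_real (2 * pi * real_of_int (- occupation x j) / 3))"
    unfolding number_op_eq by (intro eq_matI) (auto simp: mat_diag_def)
  then show ?thesis
    by (simp only: pulse_mode_def mat_exp_mat_diag cubic_phase_def cis_conv_exp)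
qed

text \<open>For \<open>b = - 1\<close> the power is the inverse in the ring, identified by
  uniqueness of inverses.\<close>

lemma mat_diag_int_pow:
  assumes "b \<in> {- 1, 0, 1}"
  shows "mat_diag (fock_dim n) (\<lambda>x. cubic_phase (k x)) [^]\<^bsub>op_ring n\<^esub> b
    = mat_diag (fock_dim n) (\<lambda>x. cubic_phase (b * k x))"
proof -
  interpret ring "op_ring n" by (rule ring_mat)
  let ?D = "\<lambda>k. mat_diag (fock_dim n) (\<lambda>x. cubic_phase (k x))"
  have carrier: "?D k \<in> carrier (op_ring n)" for k by (simp add: ring_mat_simps)
  have mult: "?D k \<otimes>\<^bsub>op_ring n\<^esub> ?D (\<lambda>x. - k x) = \<one>\<^bsub>op_ring n\<^esub>"
    "?D (\<lambda>x. - k x) \<otimes>\<^bsub>op_ring n\<^esub> ?D k = \<one>\<^bsub>op_ring n\<^esub>"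
    by (simp_all add: ring_mat_simps flip: cubic_phase_add)
  then have U: "?D k \<in> Units (op_ring n)"
    using carrier by (auto simp: Units_def)
  have "inv\<^bsub>op_ring n\<^esub> (?D k) = ?D (\<lambda>x. - k x)"
    by (rule inv_unique [OF Units_l_inv [OF U] mult(1) carrier Units_inv_closed [OF U] carrier])
  moreover have "?D k [^]\<^bsub>op_ring n\<^esub> Suc 0 = ?D k"
    using carrier [of k] by simp
  ultimately show ?thesis
    using assms by (elim insertE emptyE) (simp_all add: int_pow_def2 ring_mat_simps)
qed

lemma op_prod_mat_diag:
  "op_prod n (map (\<lambda>j. mat_diag (fock_dim n) (d j)) js)
    = mat_diag (fock_dim n) (\<lambda>x. prod_list (map (\<lambda>j. d j x) js))"
  by (induction js) (simp_all add: op_prod_def)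

lemma prod_list_upt: "prod_list (map f [1..<n + 1]) = (\<Prod>j\<in>{1..n}. f j)"
  by (subst prod.distinct_set_conv_list [symmetric]) (auto intro: prod.cong)

lemma pulse_eq:
  assumes "b \<in> strings n"
  shows "pulse n b = mat_diag (fock_dim n) (\<lambda>x. cubic_phase (- dot n b (occupation x)))"
proof -
  have "map (\<lambda>j. pulse_mode n j [^]\<^bsub>op_ring n\<^esub> b j) [1..<n + 1]
      = map (\<lambda>j. mat_diag (fock_dim n) (\<lambda>x. cubic_phase (b j * - occupation x j))) [1..<n + 1]"
  proof (intro map_cong refl)
    fix j assume "j \<in> set [1..<n + 1]"
    then have "b j \<in> {- 1, 0, 1}" by (intro strings_entry [OF assms]) auto
    then show "pulse_mode n j [^]\<^bsub>op_ring n\<^esub> b j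
        = mat_diag (fock_dim n) (\<lambda>x. cubic_phase (b j * - occupation x j))"
      unfolding pulse_mode_eq by (rule mat_diag_int_pow)
  qed
  then have "pulse n b = mat_diag (fock_dim n)
      (\<lambda>x. prod_list (map (\<lambda>j. cubic_phase (b j * - occupation x j)) [1..<n + 1]))"
    by (simp only: pulse_def op_prod_mat_diag)
  then show ?thesis
    by (simp only: prod_list_upt dot_def sum_negf [symmetric] cubic_phase_sum mult_minus_right)
qed

lemma pulse_carrier [simp]: "b \<in> strings n \<Longrightarrow> pulse n b \<in> carrier_mat (fock_dim n) (fock_dim n)"
  by (simp add: pulse_eq)

section \<open>Charges of operator strings\<close>

text \<open>The entry at \<open>(x, y)\<close> leads from state \<open>y\<close> to state
  \<open>x\<close>, so \<open>M\<close> changes the occupation numbers by \<open>a\<close>. As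
  \<open>j\<close> is unrestricted, the charges below are explicitly set to 0 away from the modes
  concerned.\<close>

definition charged :: "nat \<Rightarrow> (nat \<Rightarrow> int) \<Rightarrow> complex mat \<Rightarrow> bool"
  where "charged n a M \<longleftrightarrow> M \<in> carrier_mat (fock_dim n) (fock_dim n) \<and>
    (\<forall>x<fock_dim n. \<forall>y<fock_dim n. M $$ (x, y) \<noteq> 0 \<longrightarrow> (\<forall>j. occupation x j = occupation y j + a j))"

lemma charged_mult:
  assumes "charged n a A" "charged n b B"
  shows "charged n (\<lambda>j. a j + b j) (A * B)"
  unfolding charged_def
proof (intro conjI allI impI)
  show "A * B \<in> carrier_mat (fock_dim n) (fock_dim n)"
    using assms by (auto simp: charged_def)
  fix x y j assume xy: "x < fock_dim n" "y < fock_dim n" and nz: "(A * B) $$ (x, y) \<noteq> 0"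
  have "(A * B) $$ (x, y) = (\<Sum>z<fock_dim n. A $$ (x, z) * B $$ (z, y))"
    using assms xy by (auto simp: charged_def scalar_prod_def atLeast0LessThan intro!: sum.cong)
  with nz obtain z where "z < fock_dim n" "A $$ (x, z) \<noteq> 0" "B $$ (z, y) \<noteq> 0"
    by (metis (no_types, lifting) lessThan_iff mult_eq_0_iff sum.neutral)
  then show "occupation x j = occupation y j + (a j + b j)"
    using assms xy by (auto simp: charged_def)
qed

lemma charged_adjoint:
  assumes "charged n a A"
  shows "charged n (\<lambda>j. - a j) (mat_adjoint A)"
  using assms by (auto simp: charged_def)

lemma charged_creation: "charged n (\<lambda>i. if i = j then 1 else 0) (creation n j)"
  by (auto simp: charged_def creation_def occupation_def split: if_splits)

lemma charged_one: "charged n (\<lambda>i. 0) (1\<^sub>m (fock_dim n))"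
  by (auto simp: charged_def split: if_splits)

lemma charged_C_mode:
  assumes "z \<in> {- 1, 0, 1}"
  shows "charged n (\<lambda>i. if i = j then z else 0) (C_mode n j z)"
proof -
  have "(\<lambda>i. - (if i = j then 1 else 0)) = (\<lambda>i. if i = j then - 1 else 0 :: int)" by auto
  then show ?thesis
    using assms charged_creation [of n j] charged_adjoint [OF charged_creation, of n j] charged_one [of n]
    by (auto simp: C_mode_def annihilation_def cong: if_cong)
qed

text \<open>Charges add under products; the modes are distinct, so each receives its charge from a
  single factor.\<close>

lemma charged_op_prod:
  assumes "distinct js" "\<And>j. j \<in> set js \<Longrightarrow> a j \<in> {- 1, 0, 1}"
  shows "charged n (\<lambda>i. if i \<in> set js then a i else 0) (op_prod n (map (\<lambda>j. C_mode n j (a j)) js))"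
  using assms
proof (induction js)
  case Nil
  then show ?case by (simp add: op_prod_def charged_one)
next
  case (Cons j js)
  have "charged n (\<lambda>i. (if i = j then a j else 0) + (if i \<in> set js then a i else 0))
      (C_mode n j (a j) * op_prod n (map (\<lambda>j. C_mode n j (a j)) js))"
    using Cons by (intro charged_mult charged_C_mode) auto
  moreover have "(\<lambda>i. (if i = j then a j else 0) + (if i \<in> set js then a i else 0))
      = (\<lambda>i. if i \<in> set (j # js) then a i else 0)"
    using Cons.prems by auto
  ultimately show ?case by (simp add: op_prod_def)
qed

text \<open>A string is \<open>undefined\<close> outside \<open>{1..n}\<close>, so its charge is cut
  off there.\<close>

lemma charged_C_string:
  assumes "a \<in> strings n"
  shows "charged n (\<lambda>i. if i \<in> {1..n} then a i else 0) (C_string n a)"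
proof -
  have "set [1..<n + 1] = {1..n}" by auto
  then show ?thesis
    unfolding C_string_def
    using charged_op_prod [of "[1..<n + 1]" a n] strings_entry [OF assms] by fastforce
qed

lemma C_string_carrier: "a \<in> strings n \<Longrightarrow> C_string n a \<in> carrier_mat (fock_dim n) (fock_dim n)"
  using charged_C_string by (auto simp: charged_def)

text \<open>A nonzero entry changes the occupation numbers by \<open>a\<close>, and pairing this
  change with \<open>b\<close> gives \<open>dot n a b\<close>. So a pulse multiplies the whole
  string by one phase.\<close>

lemma C_string_phase:
  assumes a: "a \<in> strings n" and "x < fock_dim n" "y < fock_dim n"
  shows "cubic_phase (dot n b (occupation x) - dot n b (occupation y)) * C_string n a $$ (x, y)
    = cubic_phase (dot n a b) * C_string n a $$ (x, y)"
proof (cases "C_string n a $$ (x, y) = 0")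
  case False
  then have "occupation x j = occupation y j + a j" if "j \<in> {1..n}" for j
    using charged_C_string [OF a] assms that by (auto simp: charged_def)
  then have "dot n b (occupation x) = dot n b (occupation y) + dot n a b"
    unfolding dot_def sum.distrib [symmetric] by (intro sum.cong refl) (simp add: algebra_simps)
  then show ?thesis by simp
qed simp

section \<open>Hamiltonians and their toggled terms\<close>

lemma finsum_ring_mat_index:
  assumes "finite A" "\<And>a. a \<in> A \<Longrightarrow> f a \<in> carrier_mat (fock_dim n) (fock_dim n)"
  shows "(\<Oplus>\<^bsub>op_ring n\<^esub>a\<in>A. f a) \<in> carrier_mat (fock_dim n) (fock_dim n) \<and>
    (\<forall>x<fock_dim n. \<forall>y<fock_dim n. (\<Oplus>\<^bsub>op_ring n\<^esub>a\<in>A. f a) $$ (x, y) = (\<Sum>a\<in>A. f a $$ (x, y)))"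
proof -
  interpret ring "op_ring n" by (rule ring_mat)
  show ?thesis using assms
  proof (induction A rule: finite_induct)
    case empty
    then show ?case by (simp add: ring_mat_simps)
  next
    case (insert a A)
    have "f \<in> A \<rightarrow> carrier (op_ring n)" "f a \<in> carrier (op_ring n)"
      using insert.prems by (auto simp: ring_mat_simps)
    from finsum_insert [OF insert.hyps this] insert show ?case
      by (auto simp: ring_mat_simps)
  qed
qed

lemma finite_pos_strings: "finite (pos_strings n)"
  using pos_strings_subset finite_strings by (rule finite_subset)

lemma hamiltonian_carrier [simp]: "hamiltonian n v \<in> carrier_mat (fock_dim n) (fock_dim n)"
  and hamiltonian_index: "x < fock_dim n \<Longrightarrow> y < fock_dim n \<Longrightarrow> hamiltonian n v $$ (x, y)
    = (\<Sum>a\<in>pos_strings n. v a * C_string n a $$ (x, y) + cnj (v a * C_string n a $$ (y, x)))"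
proof -
  have C: "C_string n a \<in> carrier_mat (fock_dim n) (fock_dim n)" if "a \<in> pos_strings n" for a
    using that pos_strings_subset by (intro C_string_carrier) auto
  let ?f = "\<lambda>a. v a \<cdot>\<^sub>m C_string n a + cnj (v a) \<cdot>\<^sub>m mat_adjoint (C_string n a)"
  have H: "hamiltonian n v \<in> carrier_mat (fock_dim n) (fock_dim n) \<and>
    (\<forall>x<fock_dim n. \<forall>y<fock_dim n. hamiltonian n v $$ (x, y) = (\<Sum>a\<in>pos_strings n. ?f a $$ (x, y)))"
    unfolding hamiltonian_def using C by (intro finsum_ring_mat_index finite_pos_strings) auto
  then show "hamiltonian n v \<in> carrier_mat (fock_dim n) (fock_dim n)" by simp
  assume "x < fock_dim n" "y < fock_dim n"
  then show "hamiltonian n v $$ (x, y)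
      = (\<Sum>a\<in>pos_strings n. v a * C_string n a $$ (x, y) + cnj (v a * C_string n a $$ (y, x)))"
    using H carrier_matD [OF C] by (auto intro!: sum.cong)
qed

lemma hamiltonian_hermitian: "mat_adjoint (hamiltonian n v) = hamiltonian n v"
  using carrier_matD [OF hamiltonian_carrier]
  by (intro eq_matI) (auto simp: hamiltonian_index add.commute intro!: sum.cong)

lemma toggled_term_carrier [simp]:
  assumes "b \<in> strings n" "H \<in> carrier_mat (fock_dim n) (fock_dim n)"
  shows "toggled_term n H w b \<in> carrier_mat (fock_dim n) (fock_dim n)"
  unfolding toggled_term_def using assms
  by (intro smult_carrier_mat mult_carrier_mat [of _ _ "fock_dim n"]) auto

lemma toggled_term_index:
  assumes b: "b \<in> strings n" and H: "H \<in> carrier_mat (fock_dim n) (fock_dim n)"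
    and xy: "x < fock_dim n" "y < fock_dim n"
  shows "toggled_term n H w b $$ (x, y) = of_real (w b) *
    (cubic_phase (dot n b (occupation x) - dot n b (occupation y)) * H $$ (x, y))"
proof -
  let ?V = "pulse n b"
  have "(mat_adjoint ?V * H * ?V) $$ (x, y)
      = cubic_phase (dot n b (occupation x)) * H $$ (x, y) * cubic_phase (- dot n b (occupation y))"
    using b H xy by (simp add: pulse_eq mat_adjoint_mat_diag cnj_cubic_phase mat_diag_conj_index)
  also have "\<dots> = cubic_phase (dot n b (occupation x) + - dot n b (occupation y)) * H $$ (x, y)"
    unfolding cubic_phase_add by simp
  finally have "(mat_adjoint ?V * H * ?V) $$ (x, y)
      = cubic_phase (dot n b (occupation x) - dot n b (occupation y)) * H $$ (x, y)"
    by simp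
  then show ?thesis
    using xy carrier_matD [OF pulse_carrier [OF b]] by (simp add: toggled_term_def)
qed

lemma toggled_term_hermitian:
  assumes b: "b \<in> strings n" and H: "H \<in> carrier_mat (fock_dim n) (fock_dim n)" "mat_adjoint H = H"
  shows "mat_adjoint (toggled_term n H w b) = toggled_term n H w b"
proof (rule eq_matI)
  fix x y assume "x < dim_row (toggled_term n H w b)" "y < dim_col (toggled_term n H w b)"
  then have xy: "x < fock_dim n" "y < fock_dim n"
    using carrier_matD [OF toggled_term_carrier [OF b H(1)]] by simp_all
  have "cnj (H $$ (y, x)) = H $$ (x, y)"
    using arg_cong [OF H(2), of "\<lambda>M. M $$ (x, y)"] H(1) xy by simp
  then show "mat_adjoint (toggled_term n H w b) $$ (x, y) = toggled_term n H w b $$ (x, y)"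
    using xy carrier_matD [OF toggled_term_carrier [OF b H(1)]]
    by (simp add: toggled_term_index [OF b H(1)] cnj_cubic_phase)
qed (use carrier_matD [OF toggled_term_carrier [OF b H(1)]] in simp_all)

text \<open>Toggling multiplies the coefficient of each string by the weight and its phase. The
  weight is real, so the adjoint half receives the conjugate factor and the form of a Hamiltonian is
  kept.\<close>

lemma toggled_hamiltonian_index:
  assumes b: "b \<in> strings n" and xy: "x < fock_dim n" "y < fock_dim n"
  shows "toggled_term n (hamiltonian n v) w b $$ (x, y)
    = (\<Sum>a\<in>pos_strings n. v a * (of_real (w b) * cubic_phase (dot n a b)) * C_string n a $$ (x, y)
        + cnj (v a * (of_real (w b) * cubic_phase (dot n a b)) * C_string n a $$ (y, x)))"
proof -
  let ?q = "\<lambda>x. dot n b (occupation x)"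
  have "toggled_term n (hamiltonian n v) w b $$ (x, y)
      = (\<Sum>a\<in>pos_strings n. of_real (w b) * v a * (cubic_phase (?q x - ?q y) * C_string n a $$ (x, y))
          + cnj (of_real (w b) * v a * (cubic_phase (?q y - ?q x) * C_string n a $$ (y, x))))"
    using b xy by (simp add: toggled_term_index hamiltonian_index sum_distrib_left cnj_cubic_phase algebra_simps)
  also have "\<dots> = (\<Sum>a\<in>pos_strings n. v a * (of_real (w b) * cubic_phase (dot n a b)) * C_string n a $$ (x, y)
        + cnj (v a * (of_real (w b) * cubic_phase (dot n a b)) * C_string n a $$ (y, x)))"
  proof (intro sum.cong refl)
    fix a assume "a \<in> pos_strings n"
    then have a: "a \<in> strings n" using pos_strings_subset by auto
    show "of_real (w b) * v a * (cubic_phase (?q x - ?q y) * C_string n a $$ (x, y))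
          + cnj (of_real (w b) * v a * (cubic_phase (?q y - ?q x) * C_string n a $$ (y, x)))
        = v a * (of_real (w b) * cubic_phase (dot n a b)) * C_string n a $$ (x, y)
        + cnj (v a * (of_real (w b) * cubic_phase (dot n a b)) * C_string n a $$ (y, x))"
      \<comment> \<open>The second use, with the indices exchanged, serves the adjoint half.\<close>
      unfolding C_string_phase [OF a xy] C_string_phase [OF a xy(2,1)] by (simp only: mult_ac)
  qed
  finally show ?thesis .
qed

text \<open>The pulse is diagonal and its adjoint is its inverse, so conjugation passes through the
  exponential, and the weight merges with the time.\<close>

lemma evolution_toggled_term:
  assumes b: "b \<in> strings n" and H: "H \<in> carrier_mat (fock_dim n) (fock_dim n)"
  shows "evolution (toggled_term n H w b) s = pulsed_evolution n H w b s"
proof -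
  let ?D = "mat_diag (fock_dim n) (\<lambda>x. cubic_phase (dot n b (occupation x)))"
  let ?E = "mat_diag (fock_dim n) (\<lambda>x. cubic_phase (- dot n b (occupation x)))"
  let ?A = "(- (\<i> * complex_of_real (s * w b))) \<cdot>\<^sub>m H"
  have V: "pulse n b = ?E" "mat_adjoint (pulse n b) = ?D"
    using b by (simp_all add: pulse_eq mat_adjoint_mat_diag cnj_cubic_phase)
  have "(- (\<i> * complex_of_real s)) \<cdot>\<^sub>m toggled_term n H w b = ?D * ?A * ?E"
  proof (rule eq_matI)
    fix x y assume "x < dim_row (?D * ?A * ?E)" "y < dim_col (?D * ?A * ?E)"
    then have xy: "x < fock_dim n" "y < fock_dim n" by (simp_all add: mat_diag_def)
    have "cubic_phase (dot n b (occupation x) - dot n b (occupation y))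
        = cubic_phase (dot n b (occupation x)) * cubic_phase (- dot n b (occupation y))"
      by (simp flip: cubic_phase_add)
    then show "((- (\<i> * complex_of_real s)) \<cdot>\<^sub>m toggled_term n H w b) $$ (x, y) = (?D * ?A * ?E) $$ (x, y)"
      using xy H carrier_matD [OF toggled_term_carrier [OF b H]]
      by (simp add: mat_diag_conj_index toggled_term_index [OF b H] mult_ac)
  qed (use carrier_matD [OF toggled_term_carrier [OF b H]] in \<open>simp_all add: mat_diag_def\<close>)
  moreover have "mat_exp (?D * ?A * ?E) = ?D * mat_exp ?A * ?E"
    using H by (intro mat_exp_conj) (auto simp flip: cubic_phase_add)
  ultimately show ?thesis
    unfolding evolution_def pulsed_evolution_def V(2) unfolding V(1) by (simp only:)
qed

lemma foldr_add_mat_index: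
  assumes "set Hs \<subseteq> carrier_mat m n"
  shows "foldr (+) Hs (0\<^sub>m m n) \<in> carrier_mat m n \<and>
    (\<forall>x<m. \<forall>y<n. foldr (+) Hs (0\<^sub>m m n) $$ (x, y) = (\<Sum>H\<leftarrow>Hs. H $$ (x, y)))"
  using assms
proof (induction Hs)
  case (Cons H Hs)
  then have "foldr (+) Hs (0\<^sub>m m n) \<in> carrier_mat m n" by simp
  with Cons show ?case by auto
qed simp

text \<open>All toggled terms are combinations of the same strings, so only their coefficients add
  up. Distinctness of \<open>bs\<close> turns the sum over the list into one over the set.\<close>

lemma sum_toggled_terms:
  assumes bs: "distinct bs" "set bs \<subseteq> strings n"
    and w: "\<And>a. a \<in> pos_strings n \<Longrightarrow>
      v a * (\<Sum>b\<in>set bs. complex_of_real (w b) * cubic_phase (dot n a b)) = v' a"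
  shows "foldr (+) (map (toggled_term n (hamiltonian n v) w) bs) (0\<^sub>m (fock_dim n) (fock_dim n))
    = hamiltonian n v'" (is "?S = _")
proof (rule eq_matI)
  have "set (map (toggled_term n (hamiltonian n v) w) bs) \<subseteq> carrier_mat (fock_dim n) (fock_dim n)"
    using bs by auto
  note S = foldr_add_mat_index [OF this]
  show "dim_row ?S = dim_row (hamiltonian n v')" "dim_col ?S = dim_col (hamiltonian n v')"
    using S carrier_matD [OF hamiltonian_carrier [of n v']] by auto
  fix x y assume "x < dim_row (hamiltonian n v')" "y < dim_col (hamiltonian n v')"
  then have xy: "x < fock_dim n" "y < fock_dim n"
    using carrier_matD [OF hamiltonian_carrier [of n v']] by auto
  let ?c = "\<lambda>a b. complex_of_real (w b) * cubic_phase (dot n a b)"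
  let ?C = "\<lambda>a. C_string n a $$ (x, y)" and ?C' = "\<lambda>a. C_string n a $$ (y, x)"
  have "?S $$ (x, y) = (\<Sum>b\<in>set bs. toggled_term n (hamiltonian n v) w b $$ (x, y))"
    using S xy bs(1) by (simp add: sum.distinct_set_conv_list o_def)
  also have "\<dots> = (\<Sum>b\<in>set bs. \<Sum>a\<in>pos_strings n. v a * ?c a b * ?C a + cnj (v a * ?c a b * ?C' a))"
    using bs(2) xy by (intro sum.cong refl toggled_hamiltonian_index) auto
  also have "\<dots> = (\<Sum>a\<in>pos_strings n. \<Sum>b\<in>set bs. v a * ?c a b * ?C a + cnj (v a * ?c a b * ?C' a))"
    by (rule sum.swap)
  also have "\<dots> = (\<Sum>a\<in>pos_strings n. v a * (\<Sum>b\<in>set bs. ?c a b) * ?C a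
      + cnj (v a * (\<Sum>b\<in>set bs. ?c a b) * ?C' a))"
    by (simp only: sum.distrib cnj_sum sum_distrib_left sum_distrib_right)
  also have "\<dots> = hamiltonian n v' $$ (x, y)"
    unfolding hamiltonian_index [OF xy] using w by (intro sum.cong refl) simp
  finally show "?S $$ (x, y) = hamiltonian n v' $$ (x, y)" .
qed

theorem theorem4:
  shows "\<exists>K :: nat \<Rightarrow> real.
    \<forall>(n :: nat) (\<alpha> :: (nat \<Rightarrow> int) \<Rightarrow> complex) (\<beta> :: (nat \<Rightarrow> int) \<Rightarrow> complex).
      n \<ge> 1 \<longrightarrow> supp n \<beta> \<subseteq> supp n \<alpha> \<longrightarrow>
      (\<exists>(bs :: (nat \<Rightarrow> int) list) (lam :: (nat \<Rightarrow> int) \<Rightarrow> real).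
         length bs = 2 * card (supp n \<alpha>) \<and> distinct bs \<and> set bs \<subseteq> strings n \<and>
         (\<forall>b\<in>set bs. lam b \<ge> 0) \<and>
         (\<forall>b\<in>set bs. \<forall>s :: real.
            evolution (toggled_term n (hamiltonian n \<alpha>) lam b) s
              = pulsed_evolution n (hamiltonian n \<alpha>) lam b s) \<and>
         (\<forall>t :: real. U_eng n (hamiltonian n \<alpha>) lam bs t
            = op_prod n (map (\<lambda>b. evolution (toggled_term n (hamiltonian n \<alpha>) lam b) t) bs)) \<and>
         (\<forall>(p :: nat) (nT :: nat) (t :: real).
            p \<ge> 1 \<longrightarrow> nT \<ge> 1 \<longrightarrow> t \<ge> 0 \<longrightarrow>
            op_norm (suzuki n (map (toggled_term n (hamiltonian n \<alpha>) lam) bs) p (t / real nT) ^\<^sub>m nT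
                     - evolution (hamiltonian n \<beta>) t)
            \<le> K p * ((\<Sum>b\<leftarrow>bs. op_norm (toggled_term n (hamiltonian n \<alpha>) lam b)) ^ (2 * p + 1)
                      * t ^ (2 * p + 1) / real nT ^ (2 * p))))"
proof (intro exI [of _ "\<lambda>p. 2 * exp (suzuki_cost p)"] allI impI)
  \<comment> \<open>The constant has been chosen before \<open>n\<close>, \<alpha> and \<beta>, so
    it depends on \<open>p\<close> alone.\<close>
  fix n :: nat and \<alpha> \<beta> :: "(nat \<Rightarrow> int) \<Rightarrow> complex"
  assume supp: "supp n \<beta> \<subseteq> supp n \<alpha>"
  let ?H = "hamiltonian n \<alpha>"
  have "supp n \<alpha> \<subseteq> pos_strings n" by (auto simp: supp_def)
  then obtain bs w where bs: "length bs = 2 * card (supp n \<alpha>)" "distinct bs" "set bs \<subseteq> strings n"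
    and w: "\<And>b. b \<in> set bs \<Longrightarrow> 0 \<le> (w b :: real)"
      "\<And>a. a \<in> supp n \<alpha> \<Longrightarrow> (\<Sum>b\<in>set bs. complex_of_real (w b) * cubic_phase (dot n a b)) = \<beta> a / \<alpha> a"
    by (rule sparse_nonneg_weights_exist [where x = "\<lambda>a. \<beta> a / \<alpha> a"]) (rule that)
  \<comment> \<open>On the support of \<alpha> the weights produce the quotient
    \<open>\<beta> a / \<alpha> a\<close>; off it both coefficients vanish, by the inclusion of
    supports.\<close>
  have "\<alpha> a * (\<Sum>b\<in>set bs. complex_of_real (w b) * cubic_phase (dot n a b)) = \<beta> a"
    if "a \<in> pos_strings n" for a
  proof (cases "a \<in> supp n \<alpha>")
    case True
    then show ?thesis using w(2) by (simp add: supp_def)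
  next
    case False
    then show ?thesis using that supp by (auto simp: supp_def)
  qed
  note sum = sum_toggled_terms [OF bs(2,3) this]
  have evo: "evolution (toggled_term n ?H w b) s = pulsed_evolution n ?H w b s" if "b \<in> set bs" for b s
    using that bs(3) by (intro evolution_toggled_term) auto
  have carrier: "set (map (toggled_term n ?H w) bs) \<subseteq> carrier_mat (fock_dim n) (fock_dim n)"
    using bs(3) by auto
  have herm: "mat_adjoint H = H" if "H \<in> set (map (toggled_term n ?H w) bs)" for H
    using that bs(3) by (auto intro!: toggled_term_hermitian hamiltonian_hermitian)
  have err: "op_norm (suzuki n (map (toggled_term n ?H w) bs) p (t / real nT) ^\<^sub>m nT
        - evolution (hamiltonian n \<beta>) t)
      \<le> 2 * exp (suzuki_cost p) * ((\<Sum>b\<leftarrow>bs. op_norm (toggled_term n ?H w b)) ^ (2 * p + 1)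
          * t ^ (2 * p + 1) / real nT ^ (2 * p))"
    if "1 \<le> p" "1 \<le> nT" "0 \<le> t" for p nT t
    using suzuki_error [OF carrier herm sum [symmetric] hamiltonian_hermitian hamiltonian_carrier, of p nT t] that
    by (simp add: o_def)
  have "map (\<lambda>b. pulsed_evolution n ?H w b t) bs = map (\<lambda>b. evolution (toggled_term n ?H w b) t) bs" for t
    using evo by simp
  then have U: "U_eng n ?H w bs t = op_prod n (map (\<lambda>b. evolution (toggled_term n ?H w b) t) bs)" for t
    by (simp only: U_eng_def)
  show "\<exists>bs lam. length bs = 2 * card (supp n \<alpha>) \<and> distinct bs \<and> set bs \<subseteq> strings n \<and>
         (\<forall>b\<in>set bs. lam b \<ge> 0) \<and>
         (\<forall>b\<in>set bs. \<forall>s :: real.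
            evolution (toggled_term n (hamiltonian n \<alpha>) lam b) s
              = pulsed_evolution n (hamiltonian n \<alpha>) lam b s) \<and>
         (\<forall>t :: real. U_eng n (hamiltonian n \<alpha>) lam bs t
            = op_prod n (map (\<lambda>b. evolution (toggled_term n (hamiltonian n \<alpha>) lam b) t) bs)) \<and>
         (\<forall>(p :: nat) (nT :: nat) (t :: real).
            p \<ge> 1 \<longrightarrow> nT \<ge> 1 \<longrightarrow> t \<ge> 0 \<longrightarrow>
            op_norm (suzuki n (map (toggled_term n (hamiltonian n \<alpha>) lam) bs) p (t / real nT) ^\<^sub>m nT
                     - evolution (hamiltonian n \<beta>) t)
            \<le> 2 * exp (suzuki_cost p) * ((\<Sum>b\<leftarrow>bs. op_norm (toggled_term n (hamiltonian n \<alpha>) lam b)) ^ (2 * p + 1)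
                      * t ^ (2 * p + 1) / real nT ^ (2 * p)))"
    by (intro exI [of _ bs] exI [of _ w] conjI ballI allI impI)
      (rule bs(1) bs(2) bs(3) w(1) evo U err; assumption)+
qed

end
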